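(* There is an absolute constant $C$ such that for every fixed $d\ge 2$, with $p=d/n$, with probability tending to $1$ as $n\to\infty$, $$\overrightarrow{r_1}(\overrightarrow{G}(n,p))\le n\cdot(\log n)^{C d(\log d)^2}.$$
   Context: All digraphs are simple and oriented. $G(n,p)$ is the Erdős–Rényi random graph on vertex set $[n]=\{1,\dots,n\}$ (each edge present independently with probability $p$), and $\overrightarrow{G}(n,p)$ is the acyclic digraph obtained by orienting each edge $\{i,j\}$ with $i<j$ from $i$ to $j$. A copy of $H$ in $T$ is given by an injective map $V(H)\to V(T)$ sending edges of $H$ to edges of $T$ with orientations preserved. For an acyclic digraph $H$, $\overrightarrow{r_1}(H)$ is the least $N$ such that every tournament on $N$ vertices contains a copy of $H$. All logarithms are to base $2$. *)

theory Defs
  imports "HOL-Probability.Probability" "HOL-Probability.Product_PMF" "Graph_Theory.Pair_Digraph"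
begin

definition tournament :: "'a pair_pre_digraph \<Rightarrow> bool" where
  "tournament T \<longleftrightarrow> pair_digraph T \<and>
     (\<forall>u\<in>pverts T. \<forall>v\<in>pverts T. u \<noteq> v \<longrightarrow> ((u, v) \<in> parcs T \<longleftrightarrow> (v, u) \<notin> parcs T))"

definition contains_copy :: "'a pair_pre_digraph \<Rightarrow> 'b pair_pre_digraph \<Rightarrow> bool" where
  "contains_copy T H \<longleftrightarrow> (\<exists>f. inj_on f (pverts H) \<and> f ` pverts H \<subseteq> pverts T \<and>
     (\<forall>(u, v)\<in>parcs H. (f u, f v) \<in> parcs T))"

text \<open>
  Every finite tournament is isomorphic to one with vertices in \<^typ>\<open>nat\<close>, so quantifying over
  tournaments on this type loses no generality. For finite acyclic \<open>H\<close> some \<open>N\<close> with the property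
  exists; for other \<open>H\<close> the value is meaningless.
\<close>
definition oriented_ramsey :: "'a pair_pre_digraph \<Rightarrow> nat" where
  "oriented_ramsey H =
     (LEAST N. \<forall>T :: nat pair_pre_digraph. tournament T \<and> card (pverts T) = N \<longrightarrow> contains_copy T H)"

definition possible_edges :: "nat \<Rightarrow> nat set set" where
  "possible_edges n = {e. e \<subseteq> {1..n} \<and> card e = 2}"

text \<open>
  The vertex set \<open>{1..n}\<close> is deterministic, so the random graph $G(n,p)$ is given by its edge set.
  Note that \<^const>\<open>bernoulli_pmf\<close> truncates its parameter to $[0,1]$.
\<close>
definition erdos_renyi :: "nat \<Rightarrow> real \<Rightarrow> nat set set pmf" where
  "erdos_renyi n p =
     map_pmf (\<lambda>\<omega>. {e \<in> possible_edges n. \<omega> e})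
       (Pi_pmf (possible_edges n) False (\<lambda>_. bernoulli_pmf p))"

definition orient_edges :: "nat \<Rightarrow> nat set set \<Rightarrow> nat pair_pre_digraph" where
  "orient_edges n E = \<lparr>pverts = {1..n}, parcs = {(i, j). i < j \<and> {i, j} \<in> E}\<rparr>"

definition random_acyclic_digraph :: "nat \<Rightarrow> real \<Rightarrow> nat pair_pre_digraph pmf" where
  "random_acyclic_digraph n p = map_pmf (orient_edges n) (erdos_renyi n p)"

end

theory Submission
  imports Defs
begin

text \<open>
  A dichotomy in the spirit of Graham, Roedl and Rucinski drives the proof. Put \<open>l = \<lfloor>log 2 n\<rfloor>\<close> and
  \<open>h = 2 ^ k \<ge> 36 d\<close>, a constant. With \<open>\<delta>\<close> and \<open>\<epsilon>\<close> suitable negative powers of \<open>l\<close>, a tournament either has a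
  large vertex set in which any two disjoint subsets of relative size \<open>\<epsilon>\<close> span arcs of density at least \<open>\<delta>\<close>
  in both directions, or, iterating the failure of this \<open>k\<close> times, it has a chain of \<open>h\<close> large sets in which
  all but a \<open>1 / (4 l\<^sup>2)\<close> fraction of the arcs point forward. Both structures lose a factor \<open>l ^ O(d log d)\<close>.

  In the first case the pattern is embedded greedily along a degenerate order, because with high probability
  every vertex set \<open>X\<close> spans fewer than \<open>\<lceil>4 d\<rceil> \<cdot> card X\<close> edges. In the second case cut the pattern into
  \<open>h\<close> intervals, one for each set of the chain. The edges inside the intervals form a subcritical random graph,
  so their components have at most \<open>l\<close> vertices, and each of them fits into a transitive subtournament. The edges
  between the intervals cost little, since all degrees are at most \<open>l\<close>.
\<close>

subsection \<open>Bidense sets and forward chains in tournaments\<close>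

text \<open>The arc relation \<open>A\<close> is kept whole and only \<open>V\<close> varies, so
  that passing to a subtournament just means shrinking \<open>V\<close>.\<close>

definition semicomplete_on :: "('a \<times> 'a) set \<Rightarrow> 'a set \<Rightarrow> bool" where
  "semicomplete_on A V \<longleftrightarrow> finite V \<and> (\<forall>u\<in>V. \<forall>v\<in>V. u \<noteq> v \<longrightarrow> ((u, v) \<in> A \<longleftrightarrow> (v, u) \<notin> A))"

lemma semicomplete_on_subset: "semicomplete_on A V \<Longrightarrow> W \<subseteq> V \<Longrightarrow> semicomplete_on A W"
  unfolding semicomplete_on_def by (meson finite_subset subsetD)

lemma semicomplete_on_finite: "semicomplete_on A V \<Longrightarrow> finite V"
  unfolding semicomplete_on_def by simp

text \<open>Any vertex \<open>v\<close> has about half of the others on one side. If these are its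
  out-neighbours, \<open>v\<close> becomes the image of the least element of \<open>S\<close>; if
  they are its in-neighbours, of the greatest. The rest of \<open>S\<close> is embedded inside that
  neighbourhood by induction.\<close>

lemma transitive_embedding:
  fixes S :: "nat set"
  assumes "semicomplete_on A V" "finite S" "2 ^ card S \<le> card V"
  shows "\<exists>f. inj_on f S \<and> f ` S \<subseteq> V \<and> (\<forall>x\<in>S. \<forall>y\<in>S. x < y \<longrightarrow> (f x, f y) \<in> A)"
  using assms
proof (induction "card S" arbitrary: S V)
  case 0
  then show ?case by auto
next
  case (Suc t)
  have ne: "S \<noteq> {}" using Suc.hyps by auto
  have fV: "finite V" using Suc.prems semicomplete_on_finite by blast
  have "V \<noteq> {}" using Suc.prems(3) by auto
  then obtain v where v: "v \<in> V" by blast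
  define Out where "Out = {u \<in> V. u \<noteq> v \<and> (v, u) \<in> A}"
  define In where "In = {u \<in> V. u \<noteq> v \<and> (u, v) \<in> A}"
  have un: "V - {v} = Out \<union> In" "Out \<inter> In = {}"
    using Suc.prems(1) v unfolding semicomplete_on_def Out_def In_def by blast+
  have fin: "finite Out" "finite In" using fV unfolding Out_def In_def by auto
  have "card Out + card In = card V - 1"
    using un fin v fV by (metis card_Diff_singleton card_Un_disjoint)
  moreover have "2 * 2 ^ t \<le> card V" using Suc.prems(3) Suc.hyps(2) by (metis power_Suc)
  \<comment> \<open>If both were smaller, they would have at most \<open>2 * 2 ^ t - 2\<close>
    elements together, but \<open>V\<close> without \<open>v\<close> has at least
    \<open>2 * 2 ^ t - 1\<close>.\<close>
  ultimately consider "2 ^ t \<le> card Out" | "2 ^ t \<le> card In" by linarith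
  then show ?case
  proof cases
    case 1
    define x where "x = Min S"
    have x: "x \<in> S" "\<And>y. y \<in> S \<Longrightarrow> x \<le> y" using ne Suc.prems(2) x_def by auto
    have "t = card (S - {x})" using Suc.hyps(2) x(1) by simp
    moreover have "semicomplete_on A Out" by (rule semicomplete_on_subset[OF Suc.prems(1)]) (auto simp: Out_def)
    ultimately obtain f where f: "inj_on f (S - {x})" "f ` (S - {x}) \<subseteq> Out"
       "\<forall>a\<in>S - {x}. \<forall>b\<in>S - {x}. a < b \<longrightarrow> (f a, f b) \<in> A"
      using Suc.hyps(1)[of "S - {x}" Out] 1 Suc.prems(2) by auto
    show ?thesis
    proof (intro exI[of _ "f(x := v)"] conjI ballI impI)
      have "v \<notin> f ` (S - {x})" using f(2) unfolding Out_def by blast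
      then show "inj_on (f(x := v)) S"
        using f(1) unfolding inj_on_def by (auto simp: image_iff)
      show "f(x := v) ` S \<subseteq> V" using f(2) v unfolding Out_def by auto
      fix a b assume "a \<in> S" "b \<in> S" "a < b"
      then show "((f(x := v)) a, (f(x := v)) b) \<in> A"
        using f x unfolding Out_def by (auto simp: image_subset_iff) (metis leD)+
    qed
  next
    case 2
    define x where "x = Max S"
    have x: "x \<in> S" "\<And>y. y \<in> S \<Longrightarrow> y \<le> x" using ne Suc.prems(2) x_def by auto
    have "t = card (S - {x})" using Suc.hyps(2) x(1) by simp
    moreover have "semicomplete_on A In" by (rule semicomplete_on_subset[OF Suc.prems(1)]) (auto simp: In_def)
    ultimately obtain f where f: "inj_on f (S - {x})" "f ` (S - {x}) \<subseteq> In"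
       "\<forall>a\<in>S - {x}. \<forall>b\<in>S - {x}. a < b \<longrightarrow> (f a, f b) \<in> A"
      using Suc.hyps(1)[of "S - {x}" In] 2 Suc.prems(2) by auto
    show ?thesis
    proof (intro exI[of _ "f(x := v)"] conjI ballI impI)
      have "v \<notin> f ` (S - {x})" using f(2) unfolding In_def by blast
      then show "inj_on (f(x := v)) S"
        using f(1) unfolding inj_on_def by (auto simp: image_iff)
      show "f(x := v) ` S \<subseteq> V" using f(2) v unfolding In_def by auto
      fix a b assume "a \<in> S" "b \<in> S" "a < b"
      then show "((f(x := v)) a, (f(x := v)) b) \<in> A"
        using f x unfolding In_def by (auto simp: image_subset_iff) (metis leD)+
    qed
  qed
qed

section \<open>Double counting, density conditions and the dichotomy\<close>

lemma card_pairs_eq_sum: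
  assumes "finite X" "finite Y"
  shows "card {(x, y) \<in> X \<times> Y. P x y} = (\<Sum>x\<in>X. card {y \<in> Y. P x y})"
proof -
  have "{(x, y) \<in> X \<times> Y. P x y} = (SIGMA x:X. {y \<in> Y. P x y})" by auto
  then show ?thesis using assms by simp
qed

lemma card_pairs_swap: "card {(x, y) \<in> X \<times> Y. P x y} = card {(y, x) \<in> Y \<times> X. P x y}"
proof -
  have "{(y, x) \<in> Y \<times> X. P x y} = prod.swap ` {(x, y) \<in> X \<times> Y. P x y}" by auto
  then show ?thesis by (simp add: card_image)
qed

text \<open>Markov's inequality in counting form: each exceptional \<open>x\<close> alone accounts
  for more than \<open>t * card Y\<close> pairs. It turns a bound on the average density into one
  that holds for all but few vertices.\<close>

lemma markov_card:
  fixes c t :: real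
  assumes "finite X" "finite Y" "Y \<noteq> {}"
    and "card {(x, y) \<in> X \<times> Y. P x y} \<le> c * card X * card Y"
  shows "t * card {x \<in> X. card {y \<in> Y. P x y} > t * card Y} \<le> c * card X"
proof -
  let ?B = "{x \<in> X. card {y \<in> Y. P x y} > t * card Y}"
  have "(t * card ?B) * card Y = (\<Sum>x\<in>?B. t * card Y)" by simp
  also have "\<dots> \<le> (\<Sum>x\<in>?B. real (card {y \<in> Y. P x y}))" by (intro sum_mono) auto
  also have "\<dots> \<le> (\<Sum>x\<in>X. real (card {y \<in> Y. P x y}))" using assms(1) by (intro sum_mono2) auto
  also have "\<dots> = card {(x, y) \<in> X \<times> Y. P x y}" using card_pairs_eq_sum[OF assms(1,2), of P] by simp
  also have "\<dots> \<le> (c * card X) * card Y" using assms(4) .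
  finally show ?thesis using assms(2,3) by (simp add: card_gt_0_iff mult_le_cancel_right)
qed

text \<open>Since \<open>X\<close> and \<open>Y\<close> may be exchanged, the one inequality bounds
  the arc density in both directions.\<close>

definition bidense :: "('a \<times> 'a) set \<Rightarrow> real \<Rightarrow> real \<Rightarrow> 'a set \<Rightarrow> bool" where
  "bidense A \<epsilon> \<delta> W \<longleftrightarrow> (\<forall>X Y. X \<subseteq> W \<and> Y \<subseteq> W \<and> X \<inter> Y = {} \<and> \<epsilon> * card W \<le> card X \<and> \<epsilon> * card W \<le> card Y
     \<longrightarrow> \<delta> * card X * card Y \<le> card {(x, y) \<in> X \<times> Y. (x, y) \<in> A})"

text \<open>Non-arcs from an earlier to a later member are counted. In a tournament these are the
  arcs that point backward, as the members are disjoint.\<close>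

definition forward_chain :: "('a \<times> 'a) set \<Rightarrow> 'a set \<Rightarrow> real \<Rightarrow> real \<Rightarrow> nat \<Rightarrow> (nat \<Rightarrow> 'a set) \<Rightarrow> bool" where
  "forward_chain A V m \<eta> h B \<longleftrightarrow> (\<forall>i<h. B i \<subseteq> V \<and> m \<le> real (card (B i))) \<and>
     (\<forall>j<h. \<forall>i<j. B i \<inter> B j = {} \<and>
        real (card {(x, y) \<in> B i \<times> B j. (x, y) \<notin> A}) \<le> \<eta> * card (B i) * card (B j))"

lemma forward_chainD:
  fixes m \<eta> :: real
  assumes "forward_chain A V m \<eta> h B"
  shows "i < h \<Longrightarrow> B i \<subseteq> V" "i < h \<Longrightarrow> m \<le> card (B i)"
    "j < h \<Longrightarrow> i < j \<Longrightarrow> B i \<inter> B j = {}"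
    "j < h \<Longrightarrow> i < j \<Longrightarrow> card {(x, y) \<in> B i \<times> B j. (x, y) \<notin> A} \<le> \<eta> * card (B i) * card (B j)"
  using assms unfolding forward_chain_def by blast+

text \<open>
  The chain for \<open>k + 1\<close> is built one-sidedly: first a chain inside the typical vertices of \<open>X\<close>,
  then a chain inside those vertices of \<open>Y\<close> that are typical for every member of the first chain.
  In this order the later passage to subsets of \<open>Y\<close> cannot destroy the density.
\<close>
lemma bidense_or_chain:
  fixes \<epsilon> \<delta> \<eta> :: real
  assumes "semicomplete_on A V" "V \<noteq> {}" "0 < \<epsilon>" "\<epsilon> \<le> 1" "0 < \<delta>" "4 * 2 ^ k * \<delta> \<le> \<eta>"
    and "\<And>W. W \<subseteq> V \<Longrightarrow> (\<epsilon> / 2) ^ k * card V \<le> card W \<Longrightarrow> \<not> bidense A \<epsilon> \<delta> W"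
  shows "\<exists>B. forward_chain A V ((\<epsilon> / 2) ^ k * card V) \<eta> (2 ^ k) B"
  using assms
proof (induction k arbitrary: V)
  case 0
  then show ?case by (intro exI[of _ "\<lambda>_. V"]) (auto simp: forward_chain_def)
next
  case (Suc k)
  note eps = Suc.prems(3-5)
  have fV: "finite V" using Suc.prems(1) semicomplete_on_finite by blast
  have pw: "(\<epsilon> / 2) ^ Suc k \<le> 1" "(\<epsilon> / 2) ^ Suc k = \<epsilon> / 2 * (\<epsilon> / 2) ^ k"
    using eps by (intro power_le_one) auto
  \<comment> \<open>\<open>V\<close> itself is an admissible \<open>W\<close>, because
    \<open>(\<epsilon> / 2) ^ Suc k\<close> is at most 1.\<close>
  have "\<not> bidense A \<epsilon> \<delta> V"
    using Suc.prems(7)[of V] mult_right_mono[OF pw(1), of "real (card V)"] by simp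
  \<comment> \<open>The failing pair is read in the order \<open>Y\<close>, \<open>X\<close>: few
    arcs run from \<open>Y\<close> to \<open>X\<close>, hence nearly all run from \<open>X\<close>
    to \<open>Y\<close>, and \<open>X\<close> supplies the first half of the chain.\<close>
  then obtain Y X where XY: "X \<subseteq> V" "Y \<subseteq> V" "Y \<inter> X = {}" "\<epsilon> * card V \<le> card X" "\<epsilon> * card V \<le> card Y"
     "card {(y, x) \<in> Y \<times> X. (y, x) \<in> A} < \<delta> * card Y * card X"
    unfolding bidense_def not_all not_imp not_le by blast
  have fin: "finite X" "finite Y" using XY fV finite_subset by auto
  have V0: "card V > 0" using fV Suc.prems(2) by auto
  have "0 < \<epsilon> * card V" using eps V0 by simp
  hence cardXY: "card X > 0" "card Y > 0" using XY(4,5) by linarith+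
  hence ne: "X \<noteq> {}" "Y \<noteq> {}" by auto
  have eqs: "{(x, y) \<in> X \<times> Y. (x, y) \<notin> A} = {(x, y) \<in> X \<times> Y. (y, x) \<in> A}"
  proof -
    have "(x, y) \<notin> A \<longleftrightarrow> (y, x) \<in> A" if "x \<in> X" "y \<in> Y" for x y
    proof -
      have "x \<in> V" "y \<in> V" "x \<noteq> y" using that XY(1-3) by auto
      then show ?thesis using Suc.prems(1) unfolding semicomplete_on_def by blast
    qed
    then show ?thesis by auto
  qed
  have miss: "card {(x, y) \<in> X \<times> Y. (x, y) \<notin> A} \<le> \<delta> * card X * card Y"
    using XY(6) unfolding eqs card_pairs_swap[of X Y] by (simp add: mult.commute mult.left_commute)
  define X' where "X' = {x \<in> X. card {y \<in> Y. (x, y) \<notin> A} \<le> 2 * \<delta> * card Y}"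
  have X'X: "X' \<subseteq> X" "X' \<subseteq> V" using XY X'_def by auto
  have fX': "finite X'" using X'X fV finite_subset by blast
  have half: "card X \<le> 2 * card X'"
  proof -
    define Z where "Z = {x \<in> X. card {y \<in> Y. (x, y) \<notin> A} > 2 * \<delta> * card Y}"
    have "2 * \<delta> * card {x \<in> X. card {y \<in> Y. (x, y) \<notin> A} > 2 * \<delta> * card Y} \<le> \<delta> * card X"
      by (rule markov_card[OF fin ne(2) miss])
    hence "\<delta> * (2 * real (card Z)) \<le> \<delta> * card X"
      by (simp only: Z_def mult_ac)
    hence "2 * card Z \<le> card X" using eps(3) by simp
    moreover have "X = X' \<union> Z" unfolding X'_def Z_def by auto
    hence "card X \<le> card X' + card Z" by (simp add: card_Un_le)
    ultimately show ?thesis by linarith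
  qed
  \<comment> \<open>Passing to a set with at least half of \<open>\<epsilon> * card V\<close>
    vertices is paid for by one factor \<open>\<epsilon> / 2\<close>.\<close>
  have sizes: "(\<epsilon> / 2) ^ Suc k * card V \<le> (\<epsilon> / 2) ^ k * card Z" if "\<epsilon> * card V \<le> 2 * card Z" for Z
    using mult_left_mono[OF that, of "(\<epsilon> / 2) ^ k / 2"] eps unfolding pw(2) by (simp add: field_simps)
  have sX': "(\<epsilon> / 2) ^ Suc k * card V \<le> (\<epsilon> / 2) ^ k * card X'"
    by (rule sizes) (use half XY(4) in linarith)
  have \<eta>k: "4 * 2 ^ k * \<delta> \<le> \<eta>"
  proof -
    have "4 * 2 ^ k * \<delta> \<le> 4 * 2 ^ Suc k * \<delta>" using eps(3) by simp
    then show ?thesis using Suc.prems(6) by linarith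
  qed
  have "X' \<noteq> {}" using half cardXY by auto
  moreover have "\<not> bidense A \<epsilon> \<delta> W" if "W \<subseteq> X'" "(\<epsilon> / 2) ^ k * card X' \<le> card W" for W
    by (rule Suc.prems(7)) (use that X'X(2) sX' in \<open>auto intro: order_trans\<close>)
  ultimately have "\<exists>B. forward_chain A X' ((\<epsilon> / 2) ^ k * card X') \<eta> (2 ^ k) B"
    by (intro Suc.IH semicomplete_on_subset[OF Suc.prems(1) X'X(2)] eps \<eta>k)
  then obtain B1 where "forward_chain A X' ((\<epsilon> / 2) ^ k * card X') \<eta> (2 ^ k) B1" ..
  note B1 = forward_chainD[OF this]
  have fB1: "finite (B1 i)" if "i < 2 ^ k" for i
    using finite_subset[OF B1(1)[OF that] fX'] .
  have neB1: "B1 i \<noteq> {}" if "i < 2 ^ k" for i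
  proof -
    have "0 < (\<epsilon> / 2) ^ k * card X'" using eps half cardXY by simp
    then show ?thesis using B1(2)[OF that] by auto
  qed
  \<comment> \<open>The density of non-arcs from \<open>B1 i\<close> to \<open>Y\<close> is at most
    \<open>2 * \<delta>\<close>. The threshold \<open>t\<close> is \<open>2 * 2 ^ k\<close> times
    that, so by Markov each of the \<open>2 ^ k\<close> sets \<open>bad i\<close> takes at most a
    share \<open>1 / (2 * 2 ^ k)\<close> of \<open>Y\<close>, and together they leave at least half
    of it.\<close>
  define t where "t = 4 * 2 ^ k * \<delta>"
  define bad where "bad i = {y \<in> Y. card {x \<in> B1 i. (x, y) \<notin> A} > t * card (B1 i)}" for i
  define Y' where "Y' = Y - (\<Union>i<2 ^ k. bad i)"
  have Y'Y: "Y' \<subseteq> Y" "Y' \<subseteq> V" using XY Y'_def by auto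
  have bad: "2 * 2 ^ k * card (bad i) \<le> card Y" if i: "i < 2 ^ k" for i
  proof -
    have "card {(y, x) \<in> Y \<times> B1 i. (x, y) \<notin> A} = (\<Sum>x\<in>B1 i. card {y \<in> Y. (x, y) \<notin> A})"
      unfolding card_pairs_eq_sum[OF fB1[OF i] fin(2), symmetric] by (rule card_pairs_swap[symmetric])
    also have "real \<dots> \<le> (\<Sum>x\<in>B1 i. 2 * \<delta> * card Y)"
      unfolding of_nat_sum by (intro sum_mono) (use B1(1)[OF i] X'_def in auto)
    also have "\<dots> = 2 * \<delta> * card Y * card (B1 i)" by simp
    finally have "t * card (bad i) \<le> 2 * \<delta> * card Y" unfolding bad_def
      by (intro markov_card[OF fin(2) fB1[OF i] neB1[OF i]])
    then have "2 * \<delta> * (2 * 2 ^ k * card (bad i)) \<le> 2 * \<delta> * card Y" unfolding t_def by (simp add: algebra_simps)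
    then have "real (2 * 2 ^ k * card (bad i)) \<le> real (card Y)" using eps by (simp add: mult_ac)
    then show ?thesis by (simp only: of_nat_le_iff)
  qed
  have halfY: "card Y \<le> 2 * card Y'"
  proof -
    have "card (\<Union>i<2 ^ k. bad i) \<le> (\<Sum>i<2 ^ k. card (bad i))" by (rule card_UN_le) simp
    hence "2 * 2 ^ k * card (\<Union>i<2 ^ k. bad i) \<le> (\<Sum>i<(2::nat) ^ k. 2 * 2 ^ k * card (bad i))"
      by (simp flip: sum_distrib_left)
    also have "\<dots> \<le> (\<Sum>i<(2::nat) ^ k. card Y)" by (intro sum_mono bad) auto
    finally have "2 * card (\<Union>i<2 ^ k. bad i) \<le> card Y" by simp
    moreover have "finite (\<Union>i<(2::nat) ^ k. bad i)" using fin unfolding bad_def by auto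
    hence "card Y \<le> card Y' + card (\<Union>i<2 ^ k. bad i)"
      unfolding Y'_def using diff_card_le_card_Diff by (metis le_diff_conv)
    ultimately show ?thesis by linarith
  qed
  have sY': "(\<epsilon> / 2) ^ Suc k * card V \<le> (\<epsilon> / 2) ^ k * card Y'"
    by (rule sizes) (use halfY XY(5) in linarith)
  have "Y' \<noteq> {}" using halfY cardXY by auto
  moreover have "\<not> bidense A \<epsilon> \<delta> W" if "W \<subseteq> Y'" "(\<epsilon> / 2) ^ k * card Y' \<le> card W" for W
    by (rule Suc.prems(7)) (use that Y'Y(2) sY' in \<open>auto intro: order_trans\<close>)
  ultimately have "\<exists>B. forward_chain A Y' ((\<epsilon> / 2) ^ k * card Y') \<eta> (2 ^ k) B"
    by (intro Suc.IH semicomplete_on_subset[OF Suc.prems(1) Y'Y(2)] eps \<eta>k)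
  then obtain B2 where "forward_chain A Y' ((\<epsilon> / 2) ^ k * card Y') \<eta> (2 ^ k) B2" ..
  note B2 = forward_chainD[OF this]
  have fB2: "finite (B2 i)" if "i < 2 ^ k" for i
    using finite_subset[OF B2(1)[OF that]] finite_subset[OF Y'Y(1) fin(2)] by simp
  have cross: "card {(x, y) \<in> B1 i \<times> B2 j. (x, y) \<notin> A} \<le> \<eta> * card (B1 i) * card (B2 j)"
    if "i < 2 ^ k" "j < 2 ^ k" for i j
  proof -
    have "card {(x, y) \<in> B1 i \<times> B2 j. (x, y) \<notin> A} = (\<Sum>y\<in>B2 j. card {x \<in> B1 i. (x, y) \<notin> A})"
      unfolding card_pairs_eq_sum[OF fB2[OF that(2)] fB1[OF that(1)], symmetric] by (rule card_pairs_swap)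
    also have "real \<dots> \<le> (\<Sum>y\<in>B2 j. t * card (B1 i))"
      unfolding of_nat_sum
    proof (intro sum_mono)
      fix y assume "y \<in> B2 j"
      hence "y \<in> Y'" using B2(1) that by blast
      hence "y \<notin> bad i" "y \<in> Y" using that unfolding Y'_def by auto
      thus "real (card {x \<in> B1 i. (x, y) \<notin> A}) \<le> t * card (B1 i)" unfolding bad_def by auto
    qed
    also have "\<dots> = t * (card (B1 i) * card (B2 j))" by simp
    also have "\<dots> \<le> \<eta> * (card (B1 i) * card (B2 j))" using \<eta>k t_def by (intro mult_right_mono) auto
    finally show ?thesis by (simp add: mult.assoc)
  qed
  define B where "B i = (if i < 2 ^ k then B1 i else B2 (i - 2 ^ k))" for i
  have "forward_chain A V ((\<epsilon> / 2) ^ Suc k * card V) \<eta> (2 ^ Suc k) B"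
    unfolding forward_chain_def
  proof (intro conjI allI impI)
    fix i :: nat assume i: "i < 2 ^ Suc k"
    have "B i \<subseteq> V \<and> (\<epsilon> / 2) ^ Suc k * card V \<le> card (B i)"
    proof (cases "i < 2 ^ k")
      case True
      then show ?thesis
        using order_trans[OF B1(1) X'X(2)] order_trans[OF sX' B1(2)] by (simp_all add: B_def)
    next
      case False
      then have "i - 2 ^ k < 2 ^ k" using i by simp
      then show ?thesis
        using order_trans[OF B2(1) Y'Y(2)] order_trans[OF sY' B2(2)] False by (simp_all add: B_def)
    qed
    then show "B i \<subseteq> V" "(\<epsilon> / 2) ^ Suc k * card V \<le> card (B i)" by simp_all
  next
    fix i j :: nat assume ij: "j < 2 ^ Suc k" "i < j"
    have disj: "X' \<inter> Y' = {}" using X'X Y'Y XY(3) by blast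
    consider "j < 2 ^ k" | "i < 2 ^ k" "\<not> j < 2 ^ k" "j - 2 ^ k < 2 ^ k"
      | "\<not> i < 2 ^ k" "\<not> j < 2 ^ k" "j - 2 ^ k < 2 ^ k" "i - 2 ^ k < j - 2 ^ k"
      using ij by fastforce
    then have "B i \<inter> B j = {} \<and> card {(x, y) \<in> B i \<times> B j. (x, y) \<notin> A} \<le> \<eta> * card (B i) * card (B j)"
    proof cases
      case 1
      then have "B i = B1 i" "B j = B1 j" using ij by (simp_all add: B_def)
      then show ?thesis
        using B1(3,4)[OF 1 ij(2)] by simp_all
    next
      case 2
      then have "B i = B1 i" "B j = B2 (j - 2 ^ k)" by (simp_all add: B_def)
      then show ?thesis
        using cross[OF 2(1,3)] B1(1)[OF 2(1)] B2(1)[OF 2(3)] disj by auto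
    next
      case 3
      then have "B i = B2 (i - 2 ^ k)" "B j = B2 (j - 2 ^ k)" by (simp_all add: B_def)
      then show ?thesis
        using B2(3,4)[OF 3(3,4)] by simp_all
    qed
    then show "B i \<inter> B j = {}" "card {(x, y) \<in> B i \<times> B j. (x, y) \<notin> A} \<le> \<eta> * card (B i) * card (B j)" by simp_all
  qed
  then show ?case by blast
qed

text \<open>The pair \<open>x\<close>, \<open>y\<close> lies in members \<open>i\<close>, \<open>j\<close> of a chain, but its arc points against the order of the chain.\<close>
definition wrongly_directed :: "('a \<times> 'a) set \<Rightarrow> nat \<Rightarrow> nat \<Rightarrow> 'a \<Rightarrow> 'a \<Rightarrow> bool" where
  "wrongly_directed A i j x y \<longleftrightarrow> (i < j \<and> (x, y) \<notin> A) \<or> (j < i \<and> (y, x) \<notin> A)"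

text \<open>Markov's inequality makes each \<open>bad i j\<close> at most a fraction
  \<open>1 / (2 * h)\<close> of \<open>B i\<close>, so deleting all bad vertices leaves at least
  half. Degrees are then measured against \<open>B' j\<close>, which may be only half of
  \<open>B j\<close>; this doubles \<open>2 * h * \<eta>\<close> to
  \<open>4 * h * \<eta>\<close>.\<close>

lemma clean_chain:
  fixes m \<eta> :: real
  assumes B: "forward_chain A V m \<eta> h B" and V: "finite V" and pos: "0 < m" "0 < \<eta>"
  shows "\<exists>B'. (\<forall>i<h. B' i \<subseteq> V \<and> m / 2 \<le> card (B' i)) \<and>
    (\<forall>i<h. \<forall>j<h. \<forall>x\<in>B' i. card {y \<in> B' j. wrongly_directed A i j x y} \<le> 4 * real h * \<eta> * card (B' j))"
proof -
  note B = forward_chainD[OF B]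
  have fB: "finite (B i)" if "i < h" for i using finite_subset[OF B(1)[OF that] V] .
  have neB: "B i \<noteq> {}" if "i < h" for i using B(2)[OF that] pos by auto
  define bad where "bad i j = {x \<in> B i. card {y \<in> B j. wrongly_directed A i j x y} > 2 * real h * \<eta> * card (B j)}" for i j
  have miss: "card {(x, y) \<in> B i \<times> B j. wrongly_directed A i j x y} \<le> \<eta> * card (B i) * card (B j)"
    if "i < h" "j < h" for i j
  proof -
    consider "i < j" | "j < i" | "i = j" by linarith
    then show ?thesis
    proof cases
      case 1
      then show ?thesis using B(4)[OF that(2) 1] by (simp add: wrongly_directed_def)
    next
      case 2
      then show ?thesis using B(4)[OF that(1) 2] card_pairs_swap[of "B i" "B j" "\<lambda>x y. (y, x) \<notin> A"]
        by (simp add: wrongly_directed_def mult_ac)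
    next
      case 3
      then show ?thesis using pos by (simp add: wrongly_directed_def)
    qed
  qed
  have cbad: "2 * h * card (bad i j) \<le> card (B i)" if "i < h" "j < h" for i j
  proof -
    have "2 * real h * \<eta> * card (bad i j) \<le> \<eta> * card (B i)"
      unfolding bad_def by (rule markov_card[OF fB[OF that(1)] fB[OF that(2)] neB[OF that(2)] miss[OF that]])
    then have "\<eta> * (2 * h * card (bad i j)) \<le> \<eta> * card (B i)" by (simp add: mult_ac)
    then have "real (2 * h * card (bad i j)) \<le> real (card (B i))" using pos by simp
    then show ?thesis by (simp only: of_nat_le_iff)
  qed
  define B' where "B' i = B i - (\<Union>j<h. bad i j)" for i
  have half: "card (B i) \<le> 2 * card (B' i)" if "i < h" for i
  proof -
    have "card (\<Union>j<h. bad i j) \<le> (\<Sum>j<h. card (bad i j))" by (rule card_UN_le) simp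
    then have "2 * h * card (\<Union>j<h. bad i j) \<le> 2 * h * (\<Sum>j<h. card (bad i j))" by (rule mult_le_mono2)
    also have "\<dots> = (\<Sum>j<h. 2 * h * card (bad i j))" by (rule sum_distrib_left)
    also have "\<dots> \<le> (\<Sum>j<h. card (B i))" by (intro sum_mono cbad that) auto
    finally have "2 * card (\<Union>j<h. bad i j) \<le> card (B i)" using that by simp
    moreover have "finite (\<Union>j<h. bad i j)" using fB[OF that] unfolding bad_def by auto
    then have "card (B i) \<le> card (B' i) + card (\<Union>j<h. bad i j)"
      unfolding B'_def using diff_card_le_card_Diff by (metis le_diff_conv)
    ultimately show ?thesis by linarith
  qed
  show ?thesis
  proof (intro exI[of _ B'] conjI allI impI ballI)
    fix i assume i: "i < h"
    show "B' i \<subseteq> V" using B(1)[OF i] unfolding B'_def by blast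
    show "m / 2 \<le> card (B' i)" using B(2)[OF i] half[OF i] by linarith
  next
    fix i j x assume ij: "i < h" "j < h" and x: "x \<in> B' i"
    have "x \<in> B i" "x \<notin> bad i j" using x ij unfolding B'_def by auto
    then have "card {y \<in> B j. wrongly_directed A i j x y} \<le> 2 * real h * \<eta> * card (B j)" unfolding bad_def by auto
    moreover have "card {y \<in> B' j. wrongly_directed A i j x y} \<le> card {y \<in> B j. wrongly_directed A i j x y}"
      using fB[OF ij(2)] unfolding B'_def by (intro card_mono) auto
    moreover have "2 * real h * \<eta> * card (B j) \<le> 2 * real h * \<eta> * (2 * card (B' j))"
      using half[OF ij(2)] pos by (intro mult_left_mono) auto
    ultimately show "card {y \<in> B' j. wrongly_directed A i j x y} \<le> 4 * real h * \<eta> * card (B' j)" by linarith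
  qed
qed

subsection \<open>Embedding into a chain\<close>

text \<open>A symmetric relation on vertices instead of a set of edges, so that the component of
  \<open>v\<close> is the image of \<open>{v}\<close> under the reflexive transitive
  closure.\<close>

definition short_edges :: "(nat \<Rightarrow> nat) \<Rightarrow> nat set set \<Rightarrow> nat set \<Rightarrow> (nat \<times> nat) set" where
  "short_edges \<pi> E P = {(u, v) \<in> P \<times> P. {u, v} \<in> E \<and> \<pi> u = \<pi> v}"

text \<open>
  The components of the short edges are embedded one at a time, each of them into a transitive
  subtournament that avoids the few vertices incompatible with what has been embedded before.
\<close>
lemma chain_embedding:
  fixes \<theta> :: real
  assumes A: "semicomplete_on A V" and P: "finite P"
    and BV: "\<And>i. i < h \<Longrightarrow> B i \<subseteq> V" and Bcard: "\<And>i. i < h \<Longrightarrow> 4 * card P \<le> card (B i)"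
    and few: "\<And>i j x. i < h \<Longrightarrow> j < h \<Longrightarrow> x \<in> B i \<Longrightarrow> card {y \<in> B j. wrongly_directed A i j x y} \<le> \<theta> * card (B j)"
    and \<pi>: "\<And>v. v \<in> P \<Longrightarrow> \<pi> v < h" "mono \<pi>"
    and deg: "\<And>v. v \<in> P \<Longrightarrow> card {u \<in> P. {u, v} \<in> E} \<le> l"
    and comp: "\<And>v. v \<in> P \<Longrightarrow> card ((short_edges \<pi> E P)\<^sup>* `` {v}) \<le> l"
    and l: "2 ^ l \<le> card P" "l * l * \<theta> \<le> 1 / 4" "0 \<le> \<theta>"
  shows "\<exists>f. inj_on f P \<and> f ` P \<subseteq> V \<and> (\<forall>u\<in>P. \<forall>v\<in>P. u < v \<longrightarrow> {u, v} \<in> E \<longrightarrow> (f u, f v) \<in> A)"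
proof -
  let ?S = "short_edges \<pi> E P"
  have symS: "sym ?S" unfolding short_edges_def sym_def by (auto simp: insert_commute)
  have S\<pi>: "\<pi> u = \<pi> v" if "(u, v) \<in> ?S\<^sup>*" for u v
    using that by (induction rule: rtrancl_induct) (auto simp: short_edges_def)
  have SP: "v \<in> P" if "(u, v) \<in> ?S\<^sup>*" "u \<in> P" for u v
    using that by (induction rule: rtrancl_induct) (auto simp: short_edges_def)
  \<comment> \<open>The induction runs over unions \<open>U\<close> of components. The invariant
    also places each \<open>f v\<close> in \<open>B (\<pi> v)\<close>, because the bound
    \<open>few\<close> speaks about members of the chain.\<close>
  have "\<exists>f. inj_on f U \<and> (\<forall>v\<in>U. f v \<in> B (\<pi> v)) \<and> (\<forall>u\<in>U. \<forall>v\<in>U. u < v \<longrightarrow> {u, v} \<in> E \<longrightarrow> (f u, f v) \<in> A)"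
    if "U \<subseteq> P" "?S `` U \<subseteq> U" for U
    using finite_subset[OF that(1) P] that
  proof (induction U rule: finite_psubset_induct)
    case (psubset U)
    show ?case
    proof (cases "U = {}")
      case True
      then show ?thesis by auto
    next
      case False
      then obtain v where v: "v \<in> U" by blast
      then have vP: "v \<in> P" using psubset.prems by blast
      define C where "C = ?S\<^sup>* `` {v}"
      define i where "i = \<pi> v"
      have i: "i < h" using \<pi>(1)[OF vP] i_def by simp
      have CU: "C \<subseteq> U" unfolding C_def using Image_closed_trancl[OF psubset.prems(2)] v by blast
      have CP: "C \<subseteq> P" using CU psubset.prems by blast
      have vC: "v \<in> C" unfolding C_def by blast
      have C\<pi>: "\<pi> c = i" if "c \<in> C" for c using S\<pi>[of v c] that unfolding C_def i_def by auto
      have fC: "finite C" using CP P finite_subset by blast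
      define U' where "U' = U - C"
      have U'P: "U' \<subseteq> P" using psubset.prems U'_def by blast
      have closed: "?S `` U' \<subseteq> U'"
      proof
        fix y assume "y \<in> ?S `` U'"
        then obtain x where x: "x \<in> U" "x \<notin> C" "(x, y) \<in> ?S" unfolding U'_def by blast
        have "y \<in> U" using x psubset.prems by blast
        moreover have "(y, x) \<in> ?S" using symS x(3) unfolding sym_def by blast
        then have "y \<notin> C" using x(2) unfolding C_def by (auto intro: rtrancl_into_rtrancl)
        ultimately show "y \<in> U'" unfolding U'_def by blast
      qed
      have "U' \<subset> U" using v vC unfolding U'_def by blast
      from psubset.IH[OF this U'P closed] obtain f where f: "inj_on f U'" "\<And>v. v \<in> U' \<Longrightarrow> f v \<in> B (\<pi> v)"
        "\<And>u v. u \<in> U' \<Longrightarrow> v \<in> U' \<Longrightarrow> u < v \<Longrightarrow> {u, v} \<in> E \<Longrightarrow> (f u, f v) \<in> A" by blast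
      \<comment> \<open>These edges join the new component \<open>C\<close> to vertices already
        embedded. There are at most \<open>l * l\<close> of them: \<open>C\<close> has at most
        \<open>l\<close> vertices, each of degree at most \<open>l\<close>.\<close>
      define Nb where "Nb = {(c, u). c \<in> C \<and> u \<in> U' \<and> {u, c} \<in> E}"
      \<comment> \<open>The images already taken are forbidden, and so are the vertices whose arc to
        an embedded neighbour of \<open>C\<close> points the wrong way. The exclusion is made for
        all of \<open>C\<close> at once, which leaves the positions inside \<open>C\<close> free for
        the transitive embedding.\<close>
      define F where "F = f ` U' \<union> (\<Union>(c, u)\<in>Nb. {w \<in> B i. wrongly_directed A (\<pi> u) i (f u) w})"
      have Nb: "finite Nb" "card Nb \<le> l * l"
      proof -
        have "Nb \<subseteq> (SIGMA c:C. {u \<in> P. {u, c} \<in> E})" unfolding Nb_def using U'P by auto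
        moreover have fin: "finite (SIGMA c:C. {u \<in> P. {u, c} \<in> E})" using fC P by auto
        ultimately show "finite Nb" using finite_subset by blast
        have "card Nb \<le> card (SIGMA c:C. {u \<in> P. {u, c} \<in> E})" using \<open>Nb \<subseteq> _\<close> fin by (rule card_mono[rotated])
        also have "\<dots> = (\<Sum>c\<in>C. card {u \<in> P. {u, c} \<in> E})" using fC P by simp
        also have "\<dots> \<le> (\<Sum>c\<in>C. l)" by (intro sum_mono deg) (use CP in auto)
        also have "\<dots> \<le> l * l" using comp[OF vP] by (simp add: C_def)
        finally show "card Nb \<le> l * l" .
      qed
      have fBi: "finite (B i)" using finite_subset[OF BV[OF i] semicomplete_on_finite[OF A]] .
      have "card (\<Union>(c, u)\<in>Nb. {w \<in> B i. wrongly_directed A (\<pi> u) i (f u) w})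
          \<le> (\<Sum>(c, u)\<in>Nb. card {w \<in> B i. wrongly_directed A (\<pi> u) i (f u) w})"
        unfolding case_prod_beta by (rule card_UN_le[OF Nb(1)])
      also have "real \<dots> \<le> (\<Sum>(c, u)\<in>Nb. \<theta> * card (B i))"
        unfolding of_nat_sum case_prod_beta
      proof (intro sum_mono)
        fix p assume "p \<in> Nb"
        then have "snd p \<in> U'" unfolding Nb_def by auto
        then show "real (card {w \<in> B i. wrongly_directed A (\<pi> (snd p)) i (f (snd p)) w}) \<le> \<theta> * card (B i)"
          using few[OF \<pi>(1) i f(2)] U'P by auto
      qed
      also have "\<dots> = card Nb * (\<theta> * card (B i))" by simp
      also have "\<dots> \<le> (l * l) * (\<theta> * card (B i))"
        using Nb(2) l(3) by (intro mult_right_mono) (auto simp flip: of_nat_mult)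
      also have "\<dots> = (l * l * \<theta>) * card (B i)" by simp
      also have "\<dots> \<le> 1 / 4 * card (B i)" using l(2) by (intro mult_right_mono) auto
      finally have "card (\<Union>(c, u)\<in>Nb. {w \<in> B i. wrongly_directed A (\<pi> u) i (f u) w}) \<le> card (B i) / 4" by simp
      moreover have "card (f ` U') \<le> card P"
        using card_image_le[of U' f] card_mono[OF P U'P] finite_subset[OF U'P P] by linarith
      moreover have "card F \<le> card (f ` U') + card (\<Union>(c, u)\<in>Nb. {w \<in> B i. wrongly_directed A (\<pi> u) i (f u) w})"
        unfolding F_def by (rule card_Un_le)
      ultimately have "card F + card P \<le> card (B i)" using Bcard[OF i] by linarith
      moreover have fF: "finite F" unfolding F_def using finite_subset[OF U'P P] Nb(1) fBi by auto
      ultimately have "card P \<le> card (B i - F)" using diff_card_le_card_Diff[OF fF, of "B i"] by linarith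
      moreover have "(2::nat) ^ card C \<le> 2 ^ l" using comp[OF vP] unfolding C_def by (intro power_increasing) auto
      ultimately have "2 ^ card C \<le> card (B i - F)" using l(1) by linarith
      moreover have "semicomplete_on A (B i - F)"
        by (rule semicomplete_on_subset[OF A]) (use BV[OF i] in blast)
      ultimately obtain g where g: "inj_on g C" "g ` C \<subseteq> B i - F"
        "\<And>x y. x \<in> C \<Longrightarrow> y \<in> C \<Longrightarrow> x < y \<Longrightarrow> (g x, g y) \<in> A"
        using transitive_embedding[OF _ fC] by metis
      define f' where "f' x = (if x \<in> C then g x else f x)" for x
      have f'C: "f' x = g x" if "x \<in> C" for x using that f'_def by simp
      have f'U: "f' x = f x" if "x \<in> U'" for x using that unfolding f'_def U'_def by simp
      have U: "U = C \<union> U'" using CU U'_def by blast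
      \<comment> \<open>An edge leaving \<open>C\<close> joins different blocks, since a short edge
        stays within a component. Avoiding \<open>F\<close> then fixes the arc by the order of the
        blocks, which agrees with the order of the vertices because \<open>\<pi>\<close> is
        monotone.\<close>
      have across: "\<pi> u \<noteq> i \<and> \<not> wrongly_directed A (\<pi> u) i (f u) (g c)" if "u \<in> U'" "c \<in> C" "{u, c} \<in> E" for u c
      proof -
        have gc: "g c \<in> B i" "g c \<notin> F" using g(2) that by auto
        have "(c, u) \<in> Nb" using that unfolding Nb_def by blast
        then have "\<not> wrongly_directed A (\<pi> u) i (f u) (g c)" using gc unfolding F_def by blast
        moreover have "\<pi> u \<noteq> i"
        proof
          assume "\<pi> u = i"
          then have "(u, c) \<in> ?S" using that U'P CP C\<pi> unfolding short_edges_def by auto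
          then have "c \<in> U'" using closed that by blast
          then show False using that U'_def by blast
        qed
        ultimately show ?thesis by blast
      qed
      have "inj_on f' U"
      proof -
        have "inj_on f' C" "inj_on f' U'" using g(1) f(1) f'C f'U by (auto simp: inj_on_def)
        moreover have "f' ` C \<inter> f' ` U' = {}"
        proof -
          have "f' ` C = g ` C" "f' ` U' = f ` U'" using f'C f'U by auto
          then show ?thesis using g(2) unfolding F_def by blast
        qed
        ultimately show ?thesis unfolding U inj_on_Un by blast
      qed
      moreover have "f' x \<in> B (\<pi> x)" if "x \<in> U" for x
        using that g(2) f(2) C\<pi> f'C f'U unfolding U by auto
      moreover have "(f' x, f' y) \<in> A" if "x \<in> U" "y \<in> U" "x < y" "{x, y} \<in> E" for x y
      proof -
        have le: "\<pi> x \<le> \<pi> y" using \<pi>(2) that(3) by (simp add: mono_def)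
        consider "x \<in> C" "y \<in> C" | "x \<in> U'" "y \<in> U'" | "x \<in> C" "y \<in> U'" | "x \<in> U'" "y \<in> C"
          using \<open>x \<in> U\<close> \<open>y \<in> U\<close> unfolding U by blast
        then show ?thesis
        proof cases
          case 1
          then show ?thesis using g(3) that f'C by simp
        next
          case 2
          then show ?thesis using f(3) that f'U by simp
        next
          case 3
          then have "\<pi> y \<noteq> i" "\<not> wrongly_directed A (\<pi> y) i (f y) (g x)" using across[of y x] that by (auto simp: insert_commute)
          moreover have "i \<le> \<pi> y" using le C\<pi>[OF 3(1)] by simp
          ultimately show ?thesis using f'C[OF 3(1)] f'U[OF 3(2)] by (simp add: wrongly_directed_def)
        next
          case 4
          then have "\<pi> x \<noteq> i" "\<not> wrongly_directed A (\<pi> x) i (f x) (g y)" using across[of x y] that by auto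
          moreover have "\<pi> x \<le> i" using le C\<pi>[OF 4(2)] by simp
          ultimately show ?thesis using f'C[OF 4(2)] f'U[OF 4(1)] by (simp add: wrongly_directed_def)
        qed
      qed
      ultimately show ?thesis by blast
    qed
  qed
  moreover have "?S `` P \<subseteq> P" unfolding short_edges_def by auto
  ultimately obtain f where "inj_on f P" "\<And>v. v \<in> P \<Longrightarrow> f v \<in> B (\<pi> v)"
     "\<forall>u\<in>P. \<forall>v\<in>P. u < v \<longrightarrow> {u, v} \<in> E \<longrightarrow> (f u, f v) \<in> A" by (metis order_refl)
  then show ?thesis using BV \<pi>(1) by (intro exI[of _ f]) blast
qed

subsection \<open>Embedding into a bidense set\<close>

text \<open>Reversing all arcs exchanges the roles of \<open>X\<close> and \<open>Y\<close>. This
  transfers statements about out-degrees to in-degrees.\<close>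

lemma bidense_converse:
  assumes "bidense A \<epsilon> \<delta> W"
  shows "bidense (A\<inverse>) \<epsilon> \<delta> W"
  unfolding bidense_def
proof (intro allI impI)
  fix X Y assume *: "X \<subseteq> W \<and> Y \<subseteq> W \<and> X \<inter> Y = {} \<and> \<epsilon> * card W \<le> card X \<and> \<epsilon> * card W \<le> card Y"
  have "\<delta> * card Y * card X \<le> card {(y, x) \<in> Y \<times> X. (y, x) \<in> A}"
    by (rule assms[unfolded bidense_def, rule_format]) (use * in auto)
  also have "card {(y, x) \<in> Y \<times> X. (y, x) \<in> A} = card {(x, y) \<in> X \<times> Y. (x, y) \<in> A\<inverse>}"
    unfolding converse_iff by (rule card_pairs_swap)
  finally show "\<delta> * card X * card Y \<le> card {(x, y) \<in> X \<times> Y. (x, y) \<in> A\<inverse>}" by (simp only: mult_ac)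
qed

text \<open>If there were \<open>\<epsilon> * card W\<close> exceptional vertices, take
  \<open>X\<close> of about that size among them and \<open>Y = C - X\<close>. As
  \<open>card X\<close> is at most half of \<open>card C\<close>, \<open>Y\<close> is still large,
  and the arcs from \<open>X\<close> to \<open>Y\<close> are too few for a bidense set.\<close>

lemma bidense_few_low_outdegree:
  fixes \<epsilon> \<delta> :: real
  assumes bi: "bidense A \<epsilon> \<delta> W" and W: "finite W" "1 \<le> \<epsilon> * card W" and C: "C \<subseteq> W" "4 * \<epsilon> * card W \<le> card C"
    and \<delta>: "0 < \<delta>"
  shows "card {w \<in> W. card {c \<in> C. (w, c) \<in> A} < \<delta> / 2 * card C} < \<epsilon> * card W"
proof (rule ccontr)
  let ?bad = "{w \<in> W. card {c \<in> C. (w, c) \<in> A} < \<delta> / 2 * card C}"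
  assume "\<not> card ?bad < \<epsilon> * card W"
  then have "nat \<lceil>\<epsilon> * card W\<rceil> \<le> card ?bad" by (simp add: ceiling_le_iff nat_le_iff)
  then obtain X where X: "X \<subseteq> ?bad" "card X = nat \<lceil>\<epsilon> * card W\<rceil>" "finite X"
    by (rule obtain_subset_with_card_n)
  \<comment> \<open>Rounding up at most doubles the size, because
    \<open>1 \<le> \<epsilon> * card W\<close>.\<close>
  have X1: "\<epsilon> * card W \<le> card X" "card X \<le> 2 * (\<epsilon> * card W)" using X(2) W(2) by linarith+
  have fC: "finite C" using C(1) W(1) finite_subset by blast
  define Y where "Y = C - X"
  have "card C \<le> card Y + card X" unfolding Y_def using diff_card_le_card_Diff[OF X(3), of C] by linarith
  then have Y: "card C \<le> 2 * card Y" "\<epsilon> * card W \<le> card Y" using X1 C(2) W(2) by linarith+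
  have fY: "finite Y" using fC Y_def by simp
  have ne: "X \<noteq> {}" using X1 W(2) by auto
  have "\<delta> * card X * card Y \<le> card {(x, y) \<in> X \<times> Y. (x, y) \<in> A}"
  proof (rule bi[unfolded bidense_def, rule_format])
    show "X \<subseteq> W \<and> Y \<subseteq> W \<and> X \<inter> Y = {} \<and> \<epsilon> * card W \<le> card X \<and> \<epsilon> * card W \<le> card Y"
      using X(1) C(1) X1 Y unfolding Y_def by auto
  qed
  also have "\<dots> = (\<Sum>x\<in>X. real (card {y \<in> Y. (x, y) \<in> A}))"
    unfolding card_pairs_eq_sum[OF X(3) fY] by simp
  also have "\<dots> < (\<Sum>x\<in>X. \<delta> / 2 * card C)"
  proof (rule sum_strict_mono[OF X(3) ne])
    fix x assume "x \<in> X"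
    then have "card {c \<in> C. (x, c) \<in> A} < \<delta> / 2 * card C" using X(1) by blast
    moreover have "card {y \<in> Y. (x, y) \<in> A} \<le> card {c \<in> C. (x, c) \<in> A}"
      using fC unfolding Y_def by (intro card_mono) auto
    ultimately show "real (card {y \<in> Y. (x, y) \<in> A}) < \<delta> / 2 * card C" by linarith
  qed
  also have "\<dots> = \<delta> * card X * (card C / 2)" by simp
  also have "\<dots> \<le> \<delta> * card X * card Y" using Y(1) \<delta> by (intro mult_left_mono) auto
  finally show False by simp
qed

text \<open>The arc that a pattern edge \<open>{x, u}\<close> demands between the images \<open>a\<close> of \<open>x\<close> and \<open>b\<close> of \<open>u\<close>.\<close>
definition well_directed :: "('a \<times> 'a) set \<Rightarrow> nat \<Rightarrow> nat \<Rightarrow> 'a \<Rightarrow> 'a \<Rightarrow> bool" where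
  "well_directed A x u a b \<longleftrightarrow> (if x < u then (a, b) \<in> A else (b, a) \<in> A)"

lemma bidense_few_low_degree:
  fixes \<epsilon> \<delta> :: real
  assumes "bidense A \<epsilon> \<delta> W" "finite W" "1 \<le> \<epsilon> * card W" "C \<subseteq> W" "4 * \<epsilon> * card W \<le> card C" "0 < \<delta>"
  shows "card {w \<in> W. card {c \<in> C. well_directed A x u w c} < \<delta> / 2 * card C} < \<epsilon> * card W"
  using bidense_few_low_outdegree[OF assms(1-6)] bidense_few_low_outdegree[OF bidense_converse[OF assms(1)] assms(2-6)]
  by (cases "x < u") (simp_all add: well_directed_def)

text \<open>Greedy embedding with candidate sets. Embedding a vertex shrinks the candidates of a
  later neighbour by a factor \<open>\<delta> / 2\<close> at worst; with at most \<open>D\<close>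
  earlier neighbours they never fall below \<open>(\<delta> / 2) ^ D * card W\<close>. The new image
  has to avoid the used vertices and, for each of at most \<open>l\<close> later neighbours, at most
  \<open>\<epsilon> * card W\<close> vertices with few suitable arcs into its candidates;
  \<open>room\<close> provides for this.\<close>

lemma bidense_embedding:
  fixes \<epsilon> \<delta> :: real and vs :: "nat list"
  assumes bi: "bidense A \<epsilon> \<delta> W" and W: "finite W" "1 \<le> \<epsilon> * card W" and \<delta>: "0 < \<delta>" "\<delta> \<le> 1"
    and vs: "distinct vs"
    and bdeg: "\<And>i. i < length vs \<Longrightarrow> card {x \<in> set (take i vs). {x, vs ! i} \<in> E} \<le> D"
    and deg: "\<And>v. v \<in> set vs \<Longrightarrow> card {u \<in> set vs. {v, u} \<in> E} \<le> l"
    and \<epsilon>: "4 * \<epsilon> \<le> (\<delta> / 2) ^ D"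
    and room: "length vs + l * \<epsilon> * card W < (\<delta> / 2) ^ D * card W"
  shows "\<exists>f. inj_on f (set vs) \<and> f ` set vs \<subseteq> W \<and>
    (\<forall>u\<in>set vs. \<forall>v\<in>set vs. u < v \<longrightarrow> {u, v} \<in> E \<longrightarrow> (f u, f v) \<in> A)"
proof -
  define \<sigma> where "\<sigma> = \<delta> / 2"
  have \<sigma>: "0 < \<sigma>" "\<sigma> \<le> 1" using \<delta> by (auto simp: \<sigma>_def)
  \<comment> \<open>Candidates may include vertices that are already in use; injectivity is ensured
    only when the image is picked.\<close>
  define cand where "cand f Q u = {w \<in> W. \<forall>x\<in>Q. {x, u} \<in> E \<longrightarrow> well_directed A x u (f x) w}" for f Q u
  define emb where "emb f i Q \<longleftrightarrow> inj_on f Q \<and> f ` Q \<subseteq> W \<and>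
      (\<forall>u\<in>Q. \<forall>v\<in>Q. u < v \<longrightarrow> {u, v} \<in> E \<longrightarrow> (f u, f v) \<in> A) \<and>
      (\<forall>j. i \<le> j \<and> j < length vs \<longrightarrow>
        \<sigma> ^ card {x \<in> Q. {x, vs ! j} \<in> E} * card W \<le> card (cand f Q (vs ! j)))" for f i Q
  have "\<exists>f. emb f i (set (take i vs))"
    if "i \<le> length vs" for i
    using that
  proof (induction i)
    case 0
    then show ?case by (auto simp: cand_def emb_def)
  next
    case (Suc i)
    define Q where "Q = set (take i vs)"
    define v where "v = vs ! i"
    have i: "i < length vs" using Suc.prems by simp
    obtain f where emb: "emb f i Q" using Suc.IH i unfolding Q_def by auto
    have f: "inj_on f Q" "f ` Q \<subseteq> W"
      "\<And>u v. u \<in> Q \<Longrightarrow> v \<in> Q \<Longrightarrow> u < v \<Longrightarrow> {u, v} \<in> E \<Longrightarrow> (f u, f v) \<in> A"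
      and large: "\<And>j. i \<le> j \<Longrightarrow> j < length vs \<Longrightarrow>
        \<sigma> ^ card {x \<in> Q. {x, vs ! j} \<in> E} * card W \<le> card (cand f Q (vs ! j))"
      using emb unfolding emb_def by simp_all
    have Q': "set (take (Suc i) vs) = insert v Q" using i by (simp add: take_Suc_conv_app_nth Q_def v_def)
    have notin: "vs ! j \<notin> Q" if "i \<le> j" "j < length vs" for j
    proof
      assume "vs ! j \<in> Q"
      then obtain k where "k < length (take i vs)" "vs ! j = take i vs ! k" unfolding Q_def in_set_conv_nth by auto
      then show False using that vs i by (simp add: nth_eq_iff_index_eq)
    qed
    have vQ: "v \<notin> Q" using notin[of i] i v_def by simp
    have fQ: "finite Q" unfolding Q_def by simp
    have ge: "\<sigma> ^ D * card W \<le> card (cand f Q (vs ! j))" if "i \<le> j" "j < length vs" for j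
    proof -
      have "card {x \<in> Q. {x, vs ! j} \<in> E} \<le> card {x \<in> set (take j vs). {x, vs ! j} \<in> E}"
        using set_take_subset_set_take[OF that(1), of vs] unfolding Q_def by (intro card_mono) auto
      then have "card {x \<in> Q. {x, vs ! j} \<in> E} \<le> D" using bdeg[OF that(2)] by linarith
      then have "\<sigma> ^ D \<le> \<sigma> ^ card {x \<in> Q. {x, vs ! j} \<in> E}" using \<sigma> by (intro power_decreasing) auto
      then show ?thesis using large[OF that] by (meson mult_right_mono of_nat_0_le_iff order_trans)
    qed
    define J where "J = {j. i < j \<and> j < length vs \<and> {v, vs ! j} \<in> E}"
    define bad where "bad j = {w \<in> W. card {c \<in> cand f Q (vs ! j). well_directed A v (vs ! j) w c}
        < \<sigma> * card (cand f Q (vs ! j))}" for j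
    have J: "finite J" "card J \<le> l"
    proof -
      show "finite J" unfolding J_def by simp
      have "inj_on (\<lambda>j. vs ! j) J" using vs by (auto simp: J_def inj_on_def nth_eq_iff_index_eq)
      then have "card J = card ((\<lambda>j. vs ! j) ` J)" by (simp add: card_image)
      also have "\<dots> \<le> card {u \<in> set vs. {v, u} \<in> E}" by (intro card_mono) (auto simp: J_def)
      also have "\<dots> \<le> l" using deg i v_def by simp
      finally show "card J \<le> l" .
    qed
    have cbad: "card (bad j) \<le> \<epsilon> * card W" if "j \<in> J" for j
    proof -
      have "4 * \<epsilon> * card W \<le> \<sigma> ^ D * card W" using \<epsilon> unfolding \<sigma>_def by (intro mult_right_mono) auto
      also have "\<dots> \<le> card (cand f Q (vs ! j))" using ge that J_def by auto
      finally show ?thesis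
        using bidense_few_low_degree[OF bi W _ _ \<delta>(1), of "cand f Q (vs ! j)" v "vs ! j"]
        unfolding bad_def \<sigma>_def by (simp add: cand_def less_imp_le)
    qed
    have "card (f ` Q \<union> (\<Union>j\<in>J. bad j)) \<le> card (f ` Q) + card (\<Union>j\<in>J. bad j)" by (rule card_Un_le)
    also have "card (f ` Q) \<le> length vs"
      using card_image_le[OF fQ, of f] card_length[of "take i vs"] i unfolding Q_def by simp
    finally have 1: "real (card (f ` Q \<union> (\<Union>j\<in>J. bad j))) \<le> length vs + real (card (\<Union>j\<in>J. bad j))" by simp
    have "real (card (\<Union>j\<in>J. bad j)) \<le> (\<Sum>j\<in>J. real (card (bad j)))"
      using card_UN_le[OF J(1), of bad] by (simp flip: of_nat_sum)
    also have "\<dots> \<le> (\<Sum>j\<in>J. \<epsilon> * card W)" by (intro sum_mono cbad)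
    also have "\<dots> = card J * (\<epsilon> * card W)" by simp
    also have "\<dots> \<le> l * (\<epsilon> * card W)" using J(2) W(2) by (intro mult_right_mono) auto
    finally have "real (card (f ` Q \<union> (\<Union>j\<in>J. bad j))) < card (cand f Q v)"
      using 1 room ge[of i] i unfolding \<sigma>_def v_def by (simp add: mult.assoc)
    then have lt: "card (f ` Q \<union> (\<Union>j\<in>J. bad j)) < card (cand f Q v)" by simp
    have fin: "finite (f ` Q \<union> (\<Union>j\<in>J. bad j))" using fQ J(1) W(1) unfolding bad_def by auto
    have "\<not> cand f Q v \<subseteq> f ` Q \<union> (\<Union>j\<in>J. bad j)"
      using card_mono[OF fin] lt by (meson leD)
    then obtain w where w: "w \<in> cand f Q v" "w \<notin> f ` Q" "\<And>j. j \<in> J \<Longrightarrow> w \<notin> bad j" by blast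
    have wW: "w \<in> W" using w(1) unfolding cand_def by blast
    define f' where "f' = f(v := w)"
    have f': "f' v = w" "\<And>x. x \<in> Q \<Longrightarrow> f' x = f x" using vQ unfolding f'_def by auto
    have cand': "cand f' (insert v Q) u = (if {v, u} \<in> E then {c \<in> cand f Q u. well_directed A v u w c} else cand f Q u)" for u
      unfolding cand_def using f' by auto
    show ?case
      unfolding Q' emb_def
    proof (intro exI[of _ f'] conjI allI impI ballI)
      show "inj_on f' (insert v Q)"
        using f(1) w(2) vQ unfolding f'_def by (auto simp: inj_on_fun_updI)
      show "f' ` insert v Q \<subseteq> W" using f(2) f' wW by auto
    next
      fix x y assume xy: "x \<in> insert v Q" "y \<in> insert v Q" "x < y" "{x, y} \<in> E"
      have dir: "well_directed A z v (f z) w" if "z \<in> Q" "{z, v} \<in> E" for z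
        using w(1) that unfolding cand_def by blast
      consider "x = v" "y \<in> Q" | "x \<in> Q" "y = v" | "x \<in> Q" "y \<in> Q" using xy by blast
      then show "(f' x, f' y) \<in> A"
      proof cases
        case 1
        then show ?thesis using dir[of y] xy f' by (simp add: well_directed_def insert_commute)
      next
        case 2
        then show ?thesis using dir[of x] xy f' by (simp add: well_directed_def)
      next
        case 3
        then show ?thesis using f(3) f' xy by simp
      qed
    next
      fix j assume j: "Suc i \<le> j \<and> j < length vs"
      let ?u = "vs ! j"
      show "\<sigma> ^ card {x \<in> insert v Q. {x, ?u} \<in> E} * card W \<le> card (cand f' (insert v Q) ?u)"
      proof (cases "{v, ?u} \<in> E")
        case True
        then have "j \<in> J" using j J_def by simp
        then have "\<sigma> * card (cand f Q ?u) \<le> card (cand f' (insert v Q) ?u)"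
          using w(3)[of j] wW True unfolding bad_def cand' by auto
        moreover have "{x \<in> insert v Q. {x, ?u} \<in> E} = insert v {x \<in> Q. {x, ?u} \<in> E}" using True by auto
        then have "card {x \<in> insert v Q. {x, ?u} \<in> E} = Suc (card {x \<in> Q. {x, ?u} \<in> E})" using vQ fQ by simp
        moreover have "\<sigma> * (\<sigma> ^ card {x \<in> Q. {x, ?u} \<in> E} * card W) \<le> \<sigma> * card (cand f Q ?u)"
          using large[of j] j \<sigma> by (intro mult_left_mono) auto
        ultimately show ?thesis by simp
      next
        case False
        then have "{x \<in> insert v Q. {x, ?u} \<in> E} = {x \<in> Q. {x, ?u} \<in> E}" by auto
        then show ?thesis using False large[of j] j unfolding cand' by simp
      qed
    qed
  qed
  from this[of "length vs"] show ?thesis by (auto simp: emb_def)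
qed

subsection \<open>Tame graphs\<close>

text \<open>Handshake count: an edge inside \<open>X\<close> is counted at most once for each of the
  two orderings of its endpoints.\<close>

lemma sum_degrees_le:
  assumes "finite X" "\<And>e. e \<in> E \<Longrightarrow> card e = 2"
  shows "(\<Sum>v\<in>X. card {u \<in> X. {u, v} \<in> E}) \<le> 2 * card {e \<in> E. e \<subseteq> X}"
proof -
  have fin: "finite {e \<in> E. e \<subseteq> X}" using assms(1) by (rule finite_subset[rotated, OF finite_Pow_iff[THEN iffD2]]) auto
  have two: "finite {(v, u). {u, v} = e} \<and> card {(v, u). {u, v} = e} \<le> 2" if e: "e \<in> E" for e
  proof -
    obtain a b where "e = {a, b}" using assms(2)[OF e] by (auto simp: card_2_iff)
    then have sub: "{(v, u). {u, v} = e} \<subseteq> {(a, b), (b, a)}" by (auto simp: doubleton_eq_iff)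
    have "card {(v, u). {u, v} = e} \<le> card {(a, b), (b, a)}" by (rule card_mono[OF _ sub]) simp
    also have "\<dots> \<le> 2" by (rule order_trans[OF card_insert_le_m1]) auto
    finally show ?thesis using finite_subset[OF sub] by blast
  qed
  have "(\<Sum>v\<in>X. card {u \<in> X. {u, v} \<in> E}) = card {(v, u) \<in> X \<times> X. {u, v} \<in> E}"
    by (rule card_pairs_eq_sum[OF assms(1) assms(1), symmetric])
  also have "\<dots> \<le> card (\<Union>e\<in>{e \<in> E. e \<subseteq> X}. {(v, u). {u, v} = e})"
  proof (rule card_mono)
    show "finite (\<Union>e\<in>{e \<in> E. e \<subseteq> X}. {(v, u). {u, v} = e})"
      by (rule finite_UN_I[OF fin]) (use two in blast)
  qed auto
  also have "\<dots> \<le> (\<Sum>e\<in>{e \<in> E. e \<subseteq> X}. card {(v, u). {u, v} = e})" by (rule card_UN_le[OF fin])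
  also have "\<dots> \<le> (\<Sum>e\<in>{e \<in> E. e \<subseteq> X}. 2)" by (intro sum_mono) (use two in auto)
  finally show ?thesis by simp
qed

text \<open>The average degree within \<open>P\<close> is below \<open>2 * b\<close>, so some vertex
  has degree at most \<open>2 * b\<close>. It goes last, and the remaining vertices, which inherit
  the sparsity, are ordered by induction.\<close>

lemma degenerate_order:
  assumes "finite P" "\<And>e. e \<in> E \<Longrightarrow> card e = 2"
    and "\<And>X. X \<subseteq> P \<Longrightarrow> X \<noteq> {} \<Longrightarrow> card {e \<in> E. e \<subseteq> X} < b * card X"
  shows "\<exists>vs. distinct vs \<and> set vs = P \<and> (\<forall>i<length vs. card {x \<in> set (take i vs). {x, vs ! i} \<in> E} \<le> 2 * b)"
  using assms(1,3)
proof (induction P rule: finite_psubset_induct)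
  case (psubset P)
  show ?case
  proof (cases "P = {}")
    case False
    have "\<exists>v\<in>P. card {u \<in> P. {u, v} \<in> E} \<le> 2 * b"
    proof (rule ccontr)
      assume "\<not> ?thesis"
      then have "(\<Sum>v\<in>P. 2 * b) \<le> (\<Sum>v\<in>P. card {u \<in> P. {u, v} \<in> E})" by (intro sum_mono) auto
      also have "\<dots> \<le> 2 * card {e \<in> E. e \<subseteq> P}" using sum_degrees_le[OF psubset.hyps assms(2)] .
      also have "\<dots> < 2 * (b * card P)" using psubset.prems[of P] False by simp
      finally show False by simp
    qed
    then obtain v where v: "v \<in> P" "card {u \<in> P. {u, v} \<in> E} \<le> 2 * b" by blast
    have "\<exists>vs. distinct vs \<and> set vs = P - {v} \<and>
        (\<forall>i<length vs. card {x \<in> set (take i vs). {x, vs ! i} \<in> E} \<le> 2 * b)"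
    proof (rule psubset.IH)
      show "P - {v} \<subset> P" using v(1) by blast
      show "card {e \<in> E. e \<subseteq> X} < b * card X" if "X \<subseteq> P - {v}" "X \<noteq> {}" for X
        by (rule psubset.prems) (use that in auto)
    qed
    then obtain vs where vs: "distinct vs" "set vs = P - {v}"
      "\<And>i. i < length vs \<Longrightarrow> card {x \<in> set (take i vs). {x, vs ! i} \<in> E} \<le> 2 * b" by blast
    show ?thesis
    proof (intro exI[of _ "vs @ [v]"] conjI allI impI)
      show "distinct (vs @ [v])" "set (vs @ [v]) = P" using vs v by auto
      fix i assume "i < length (vs @ [v])"
      then consider "i < length vs" | "i = length vs" by fastforce
      then show "card {x \<in> set (take i (vs @ [v])). {x, (vs @ [v]) ! i} \<in> E} \<le> 2 * b"
      proof cases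
        case 1
        then show ?thesis using vs(3) by (simp add: nth_append)
      next
        case 2
        have "card {x \<in> P - {v}. {x, v} \<in> E} \<le> card {u \<in> P. {u, v} \<in> E}"
          using psubset.hyps by (intro card_mono) auto
        then show ?thesis using 2 vs(2) v(2) by simp
      qed
    qed
  qed auto
qed

text \<open>Inside a component with more than \<open>l\<close> vertices, a set containing
  \<open>v\<close> is grown by one vertex and at least one edge at a time. On reaching
  \<open>l + 1\<close> vertices it spans at least \<open>l\<close> edges, which
  \<open>sparse\<close> excludes.\<close>

lemma component_card_le:
  assumes P: "finite P" "v \<in> P"
    and sparse: "\<And>X. X \<subseteq> P \<Longrightarrow> card X = Suc l \<Longrightarrow> \<forall>x\<in>X. \<forall>y\<in>X. \<pi> x = \<pi> y \<Longrightarrow> card {e \<in> E. e \<subseteq> X} < l"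
  shows "card ((short_edges \<pi> E P)\<^sup>* `` {v}) \<le> l"
proof (rule ccontr)
  let ?S = "short_edges \<pi> E P"
  define C where "C = ?S\<^sup>* `` {v}"
  assume "\<not> ?thesis"
  then have big: "Suc l \<le> card C" unfolding C_def by simp
  have C: "x \<in> P \<and> \<pi> x = \<pi> v" if "x \<in> C" for x
  proof -
    have "(v, x) \<in> ?S\<^sup>*" using that unfolding C_def by blast
    then show ?thesis using P(2) by (induction rule: rtrancl_induct) (auto simp: short_edges_def)
  qed
  have fC: "finite C" using C finite_subset[OF _ P(1)] by blast
  have grow: "\<exists>X. X \<subseteq> C \<and> v \<in> X \<and> card X = Suc k \<and> k \<le> card {e \<in> E. e \<subseteq> X}" if "Suc k \<le> card C" for k
    using that
  proof (induction k)
    case 0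
    then show ?case by (intro exI[of _ "{v}"]) (auto simp: C_def)
  next
    case (Suc k)
    then obtain X where X: "X \<subseteq> C" "v \<in> X" "card X = Suc k" "k \<le> card {e \<in> E. e \<subseteq> X}" by auto
    have fX: "finite X" using X(1) fC finite_subset by blast
    have "\<not> ?S `` X \<subseteq> X"
    proof
      assume "?S `` X \<subseteq> X"
      then have "?S\<^sup>* `` X = X" by (rule Image_closed_trancl)
      then have "C \<subseteq> X" using X(2) unfolding C_def by blast
      from card_mono[OF fX this] show False using X(3) Suc.prems by linarith
    qed
    then obtain x y where xy: "x \<in> X" "y \<notin> X" "(x, y) \<in> ?S" by blast
    have "y \<in> C" using xy X(1) unfolding C_def by (meson ImageE ImageI rtrancl.rtrancl_into_rtrancl subsetD)
    have E: "{x, y} \<in> E" using xy(3) unfolding short_edges_def by auto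
    have fin: "finite {e \<in> E. e \<subseteq> Z}" if "finite Z" for Z
      using that by (rule finite_subset[rotated, OF finite_Pow_iff[THEN iffD2]]) auto
    have "{x, y} \<notin> {e \<in> E. e \<subseteq> X}" using xy(2) by simp
    from card_insert_disjoint[OF fin[OF fX] this]
    have "Suc k \<le> card (insert {x, y} {e \<in> E. e \<subseteq> X})" using X(4) by linarith
    also have "\<dots> \<le> card {e \<in> E. e \<subseteq> insert y X}"
    proof (rule card_mono)
      show "finite {e \<in> E. e \<subseteq> insert y X}" by (rule fin) (simp add: fX)
      show "insert {x, y} {e \<in> E. e \<subseteq> X} \<subseteq> {e \<in> E. e \<subseteq> insert y X}" using E xy(1) by blast
    qed
    finally show ?case
      using X(1-3) xy(2) \<open>y \<in> C\<close> fX by (intro exI[of _ "insert y X"] conjI) simp_all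
  qed
  obtain X where X: "X \<subseteq> C" "card X = Suc l" "l \<le> card {e \<in> E. e \<subseteq> X}" using grow[OF big] by blast
  have "card {e \<in> E. e \<subseteq> X} < l"
    by (rule sparse[OF _ X(2)]) (use X(1) C in \<open>simp_all add: subset_iff\<close>)
  then show False using X(3) by simp
qed

text \<open>The blocks on which \<open>x div Suc (n div h)\<close> is constant are at most \<open>h\<close> intervals covering \<open>{1..n}\<close>.\<close>
definition tame :: "nat \<Rightarrow> nat \<Rightarrow> nat \<Rightarrow> nat \<Rightarrow> nat set set \<Rightarrow> bool" where
  "tame n h b l E \<longleftrightarrow>
    (\<forall>v\<in>{1..n}. card {u \<in> {1..n}. {u, v} \<in> E} \<le> l) \<and>
    (\<forall>X\<subseteq>{1..n}. X \<noteq> {} \<longrightarrow> card {e \<in> E. e \<subseteq> X} < b * card X) \<and>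
    (\<forall>X\<subseteq>{1..n}. card X = Suc l \<longrightarrow> (\<forall>x\<in>X. \<forall>y\<in>X. x div Suc (n div h) = y div Suc (n div h)) \<longrightarrow>
       card {e \<in> E. e \<subseteq> X} < l)"

text \<open>Both branches share the parameters. A bidense \<open>W\<close> is used with degeneracy
  \<open>D = 2 * b\<close>, and \<open>\<epsilon>\<close> is chosen so that
  \<open>l * \<epsilon>\<close> is a quarter of \<open>(\<delta> / 2) ^ (2 * b)\<close>. Without
  such a \<open>W\<close>, the chain has \<open>\<eta> = 4 * h * \<delta>\<close>, cleaning it costs
  another factor \<open>4 * h\<close>, and \<open>\<delta>\<close> is chosen to make the outcome
  \<open>1 / (4 * l * l)\<close>.\<close>

lemma tame_embedding:
  fixes \<delta> \<epsilon> :: real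
  assumes tame: "tame n (2 ^ k) b l E" and E: "\<And>e. e \<in> E \<Longrightarrow> card e = 2"
    and A: "semicomplete_on A V" and l: "1 \<le> l" "2 ^ l \<le> n"
    and \<delta>: "\<delta> = 1 / (64 * (2 ^ k)\<^sup>2 * (real l)\<^sup>2)" and \<epsilon>: "\<epsilon> = (\<delta> / 2) ^ (2 * b) / (4 * l)"
    and big: "8 * n \<le> (\<epsilon> / 2) ^ k * (\<delta> / 2) ^ (2 * b) * card V"
  shows "\<exists>f. inj_on f {1..n} \<and> f ` {1..n} \<subseteq> V \<and>
    (\<forall>u\<in>{1..n}. \<forall>v\<in>{1..n}. u < v \<longrightarrow> {u, v} \<in> E \<longrightarrow> (f u, f v) \<in> A)"
proof -
  define h :: nat where "h = 2 ^ k"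
  have deg: "card {u \<in> {1..n}. {u, v} \<in> E} \<le> l" if "v \<in> {1..n}" for v
    using tame that unfolding tame_def by blast
  have sparse: "card {e \<in> E. e \<subseteq> X} < b * card X" if "X \<subseteq> {1..n}" "X \<noteq> {}" for X
    using tame that unfolding tame_def by blast
  have forest: "card {e \<in> E. e \<subseteq> X} < l"
    if "X \<subseteq> {1..n}" "card X = Suc l" "\<forall>x\<in>X. \<forall>y\<in>X. x div Suc (n div h) = y div Suc (n div h)" for X
    using tame that unfolding tame_def h_def by blast
  define \<sigma> where "\<sigma> = \<delta> / 2"
  have h1: "1 \<le> h" unfolding h_def by simp
  have n: "l < n" using l(2) less_exp[of l] by linarith
  have \<delta>': "0 < \<delta>" "\<delta> \<le> 1"
  proof -
    have "1 \<le> (2::real) ^ k" "1 \<le> real l" using l by auto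
    then have "1 \<le> 64 * ((2 ^ k)\<^sup>2 * (real l)\<^sup>2)" using mult_mono[of 1 "((2::real) ^ k)\<^sup>2" 1 "(real l)\<^sup>2"] by (simp add: one_le_power)
    then show "0 < \<delta>" "\<delta> \<le> 1" unfolding \<delta> using l by (auto simp: divide_le_eq_1)
  qed
  have \<sigma>: "0 < \<sigma> ^ (2 * b)" "\<sigma> ^ (2 * b) \<le> 1" using \<delta>' by (auto simp: \<sigma>_def intro: power_le_one)
  have \<epsilon>': "0 < \<epsilon>" "4 * \<epsilon> \<le> \<sigma> ^ (2 * b)" "l * \<epsilon> = \<sigma> ^ (2 * b) / 4"
    using \<sigma> l unfolding \<epsilon> \<sigma>_def[symmetric] by (auto simp: field_simps)
  have \<epsilon>1: "\<epsilon> \<le> 1" using \<epsilon>'(2) \<sigma>(2) \<epsilon>'(1) by linarith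
  have V: "finite V" using A semicomplete_on_finite by blast
  have big': "8 * n \<le> \<sigma> ^ (2 * b) * ((\<epsilon> / 2) ^ k * card V)" using big unfolding \<sigma>_def by (simp add: mult_ac)
  have big'': "8 * n \<le> (\<epsilon> / 2) ^ k * card V"
  proof -
    have "\<sigma> ^ (2 * b) * ((\<epsilon> / 2) ^ k * card V) \<le> 1 * ((\<epsilon> / 2) ^ k * card V)"
      using \<sigma>(2) \<epsilon>'(1) by (intro mult_right_mono) auto
    then show ?thesis using big' by linarith
  qed
  have neV: "V \<noteq> {}" using big'' n by auto
  show ?thesis
  proof (cases "\<exists>W\<subseteq>V. (\<epsilon> / 2) ^ k * card V \<le> card W \<and> bidense A \<epsilon> \<delta> W")
    case True
    then obtain W where W: "W \<subseteq> V" "(\<epsilon> / 2) ^ k * card V \<le> card W" "bidense A \<epsilon> \<delta> W" by blast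
    have W8: "8 * n \<le> \<sigma> ^ (2 * b) * card W"
      using big' mult_left_mono[OF W(2), of "\<sigma> ^ (2 * b)"] \<sigma> by linarith
    obtain vs where vs: "distinct vs" "set vs = {1..n}"
      "\<And>i. i < length vs \<Longrightarrow> card {x \<in> set (take i vs). {x, vs ! i} \<in> E} \<le> 2 * b"
      using degenerate_order[OF finite_atLeastAtMost E sparse] by blast
    have len: "length vs = n" using distinct_card[OF vs(1)] vs(2) by simp
    have lW: "l * \<epsilon> * card W = \<sigma> ^ (2 * b) * card W / 4" using \<epsilon>'(3) by simp
    have "\<exists>f. inj_on f (set vs) \<and> f ` set vs \<subseteq> W \<and>
      (\<forall>u\<in>set vs. \<forall>v\<in>set vs. u < v \<longrightarrow> {u, v} \<in> E \<longrightarrow> (f u, f v) \<in> A)"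
    proof (rule bidense_embedding[OF W(3) _ _ \<delta>' vs(1) vs(3)])
      show "finite W" using W(1) V finite_subset by blast
      have "real l \<le> l * \<epsilon> * card W" unfolding lW using W8 n by linarith
      then have "real l * 1 \<le> real l * (\<epsilon> * card W)" by (simp only: mult.assoc mult_1_right)
      then show "1 \<le> \<epsilon> * card W" using l(1) by (simp only: mult_le_cancel_left_pos)
      show "card {u \<in> set vs. {v, u} \<in> E} \<le> l" if "v \<in> set vs" for v
        using deg that unfolding vs(2) insert_commute[of v] .
      show "4 * \<epsilon> \<le> (\<delta> / 2) ^ (2 * b)" using \<epsilon>' \<sigma>_def by simp
      \<comment> \<open>The pattern takes at most an eighth of the right-hand side and the
        low-degree vertices a quarter.\<close>
      show "length vs + l * \<epsilon> * card W < (\<delta> / 2) ^ (2 * b) * card W"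
        using lW W8 n len unfolding \<sigma>_def by linarith
    qed
    then show ?thesis using W(1) unfolding vs(2) by blast
  next
    case False
    have "\<exists>B. forward_chain A V ((\<epsilon> / 2) ^ k * card V) (4 * h * \<delta>) (2 ^ k) B"
      by (rule bidense_or_chain[OF A neV \<epsilon>'(1) \<epsilon>1 \<delta>'(1)]) (use False in \<open>auto simp: h_def\<close>)
    then obtain B where "forward_chain A V ((\<epsilon> / 2) ^ k * card V) (4 * h * \<delta>) h B" unfolding h_def by blast
    moreover have "0 < (\<epsilon> / 2) ^ k * card V" using big'' n by linarith
    moreover have "0 < 4 * h * \<delta>" using \<delta>'(1) h1 by (intro mult_pos_pos) auto
    ultimately have "\<exists>B'. (\<forall>i<h. B' i \<subseteq> V \<and> (\<epsilon> / 2) ^ k * card V / 2 \<le> card (B' i)) \<and>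
      (\<forall>i<h. \<forall>j<h. \<forall>x\<in>B' i. card {y \<in> B' j. wrongly_directed A i j x y} \<le> 4 * real h * (4 * h * \<delta>) * card (B' j))"
      by (intro clean_chain V)
    then obtain B' where B0: "(\<forall>i<h. B' i \<subseteq> V \<and> (\<epsilon> / 2) ^ k * card V / 2 \<le> card (B' i)) \<and>
      (\<forall>i<h. \<forall>j<h. \<forall>x\<in>B' i. card {y \<in> B' j. wrongly_directed A i j x y} \<le> 4 * real h * (4 * h * \<delta>) * card (B' j))" ..
    note B' = B0[THEN conjunct1, rule_format, THEN conjunct1] B0[THEN conjunct1, rule_format, THEN conjunct2]
      B0[THEN conjunct2, rule_format]
    have \<theta>: "4 * real h * (4 * h * \<delta>) = 1 / (4 * (real l)\<^sup>2)"
      unfolding \<delta> h_def by (simp add: power2_eq_square)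
    \<comment> \<open>The block length exceeds \<open>n / h\<close>, which keeps the index
      \<open>v div M\<close> below \<open>h\<close> even for \<open>v = n\<close>.\<close>
    define M where "M = Suc (n div h)"
    show ?thesis
    proof (rule chain_embedding[OF A _ B'(1) _ B'(3), where \<pi> = "\<lambda>v. v div M" and l = l])
      show "4 * card {1..n} \<le> card (B' i)" if "i < h" for i
        using B'(2)[OF that] big'' by simp
      show "v div M < h" if "v \<in> {1..n}" for v
      proof -
        have "n < h * M" unfolding M_def using h1 by (simp add: dividend_less_times_div)
        then show ?thesis using that unfolding M_def by (intro less_mult_imp_div_less) (auto simp: mult.commute)
      qed
      show "mono (\<lambda>v. v div M)" by (simp add: mono_def div_le_mono)
      show "card {u \<in> {1..n}. {u, v} \<in> E} \<le> l" if "v \<in> {1..n}" for v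
        using deg that .
      show "card ((short_edges (\<lambda>v. v div M) E {1..n})\<^sup>* `` {v}) \<le> l" if "v \<in> {1..n}" for v
        using component_card_le[OF finite_atLeastAtMost that forest] unfolding M_def .
      show "2 ^ l \<le> card {1..n}" using l by simp
      show "real l * real l * (4 * real h * (4 * h * \<delta>)) \<le> 1 / 4" unfolding \<theta> using l by (simp add: power2_eq_square)
      show "0 \<le> 4 * real h * (4 * h * \<delta>)" using \<delta>' by simp
    qed auto
  qed
qed

subsection \<open>Random graphs are tame\<close>

lemma finite_possible_edges: "finite (possible_edges n)"
  unfolding possible_edges_def by (rule finite_subset[of _ "Pow {1..n}"]) auto

lemma erdos_renyi_subset: "E \<in> set_pmf (erdos_renyi n p) \<Longrightarrow> E \<subseteq> possible_edges n"
  unfolding erdos_renyi_def by auto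

text \<open>By independence the probability is a product over all possible edges, in which those
  outside \<open>F\<close> contribute the factor 1.\<close>

lemma prob_erdos_renyi_superset:
  fixes p :: real
  assumes "0 \<le> p" "p \<le> 1" "F \<subseteq> possible_edges n"
  shows "measure_pmf.prob (erdos_renyi n p) {E. F \<subseteq> E} = p ^ card F"
proof -
  let ?B = "\<lambda>e. if e \<in> F then {True} else UNIV"
  have "(\<lambda>\<omega>. {e \<in> possible_edges n. \<omega> e}) -` {E. F \<subseteq> E} = Pi (possible_edges n) ?B"
    using assms(3) by (auto simp: Pi_def)
  then have "measure_pmf.prob (erdos_renyi n p) {E. F \<subseteq> E} =
      (\<Prod>e\<in>possible_edges n. measure_pmf.prob (bernoulli_pmf p) (?B e))"
    unfolding erdos_renyi_def measure_map_pmf by (simp add: measure_Pi_pmf_Pi finite_possible_edges)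
  also have "\<dots> = (\<Prod>e\<in>possible_edges n. if e \<in> F then p else 1)"
    using assms(1,2) by (intro prod.cong refl) (simp add: measure_pmf_single)
  also have "\<dots> = p ^ card F"
    using assms(3) by (simp add: prod.If_cases finite_possible_edges Int_absorb1)
  finally show ?thesis .
qed

text \<open>Union bound. The failures of tameness are reduced to events of this kind, where
  \<open>\<F>\<close> is a family of forbidden edge sets of equal size.\<close>

lemma prob_erdos_renyi_some_superset:
  fixes p :: real
  assumes p: "0 \<le> p" "p \<le> 1" and \<F>: "finite \<F>" "\<And>F. F \<in> \<F> \<Longrightarrow> F \<subseteq> possible_edges n \<and> card F = m"
  shows "measure_pmf.prob (erdos_renyi n p) {E. \<exists>F\<in>\<F>. F \<subseteq> E} \<le> card \<F> * p ^ m"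
proof -
  have "{E. \<exists>F\<in>\<F>. F \<subseteq> E} = (\<Union>F\<in>\<F>. {E. F \<subseteq> E})" by auto
  then have "measure_pmf.prob (erdos_renyi n p) {E. \<exists>F\<in>\<F>. F \<subseteq> E}
      \<le> (\<Sum>F\<in>\<F>. measure_pmf.prob (erdos_renyi n p) {E. F \<subseteq> E})"
    using measure_pmf.finite_measure_subadditive_finite[OF \<F>(1), of "\<lambda>F. {E. F \<subseteq> E}" "erdos_renyi n p"] by simp
  also have "\<dots> = (\<Sum>F\<in>\<F>. p ^ m)"
    by (intro sum.cong refl) (use \<F>(2) prob_erdos_renyi_superset[OF p] in auto)
  finally show ?thesis by simp
qed

text \<open>The forbidden edge sets consist of \<open>m\<close> of the \<open>k choose 2\<close>
  pairs inside some \<open>X\<close>. The condition \<open>E \<subseteq> possible_edges n\<close>,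
  which holds almost surely, guarantees that the edges inside \<open>X\<close> are such
  pairs.\<close>

lemma prob_dense_subset:
  fixes p :: real
  assumes p: "0 \<le> p" "p \<le> 1" and U: "U \<subseteq> {1..n}"
  shows "measure_pmf.prob (erdos_renyi n p)
      {E. E \<subseteq> possible_edges n \<and> (\<exists>X\<subseteq>U. card X = k \<and> m \<le> card {e \<in> E. e \<subseteq> X})}
    \<le> (card U choose k) * ((k choose 2) choose m) * p ^ m"
proof -
  have fU: "finite U" using U finite_subset by blast
  define \<X> where "\<X> = {X. X \<subseteq> U \<and> card X = k}"
  define pairs where "pairs X = {e. e \<subseteq> X \<and> card e = 2}" for X :: "nat set"
  define \<F> where "\<F> = (\<Union>X\<in>\<X>. {F. F \<subseteq> pairs X \<and> card F = m})"
  have fX: "finite \<X>" "card \<X> = card U choose k" unfolding \<X>_def using n_subsets[OF fU] fU by auto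
  have fin: "finite X" if "X \<in> \<X>" for X using that fU unfolding \<X>_def by (auto intro: finite_subset)
  have pairs: "finite (pairs X)" "card (pairs X) = k choose 2" if "X \<in> \<X>" for X
    using n_subsets[OF fin[OF that]] fin[OF that] that unfolding pairs_def \<X>_def by auto
  have \<F>: "finite \<F>" unfolding \<F>_def using fX(1) pairs(1) by auto
  have "card \<F> \<le> (\<Sum>X\<in>\<X>. card {F. F \<subseteq> pairs X \<and> card F = m})" unfolding \<F>_def by (rule card_UN_le[OF fX(1)])
  also have "\<dots> = (\<Sum>X\<in>\<X>. (k choose 2) choose m)"
    by (intro sum.cong refl) (simp add: n_subsets pairs)
  finally have card: "card \<F> \<le> (card U choose k) * ((k choose 2) choose m)" using fX(2) by simp
  have "measure_pmf.prob (erdos_renyi n p)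
      {E. E \<subseteq> possible_edges n \<and> (\<exists>X\<subseteq>U. card X = k \<and> m \<le> card {e \<in> E. e \<subseteq> X})}
     \<le> measure_pmf.prob (erdos_renyi n p) {E. \<exists>F\<in>\<F>. F \<subseteq> E}"
  proof (rule measure_pmf.finite_measure_mono, rule subsetI)
    fix E assume "E \<in> {E. E \<subseteq> possible_edges n \<and> (\<exists>X\<subseteq>U. card X = k \<and> m \<le> card {e \<in> E. e \<subseteq> X})}"
    then obtain X where E: "E \<subseteq> possible_edges n" and X: "X \<subseteq> U" "card X = k" "m \<le> card {e \<in> E. e \<subseteq> X}" by blast
    obtain F where F: "F \<subseteq> {e \<in> E. e \<subseteq> X}" "card F = m" using X(3) by (meson obtain_subset_with_card_n)
    have "F \<subseteq> pairs X" using F(1) E unfolding pairs_def possible_edges_def by auto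
    moreover have "X \<in> \<X>" using X unfolding \<X>_def by simp
    ultimately have "F \<in> \<F>" using F(2) unfolding \<F>_def by blast
    then show "E \<in> {E. \<exists>F\<in>\<F>. F \<subseteq> E}" using F(1) by blast
  qed auto
  also have "\<dots> \<le> card \<F> * p ^ m"
  proof (rule prob_erdos_renyi_some_superset[OF p \<F>])
    fix F assume "F \<in> \<F>"
    then obtain X where "X \<subseteq> U" "F \<subseteq> pairs X" "card F = m" unfolding \<F>_def \<X>_def by blast
    then show "F \<subseteq> possible_edges n \<and> card F = m" using U unfolding pairs_def possible_edges_def by blast
  qed
  also have "\<dots> \<le> real ((card U choose k) * ((k choose 2) choose m)) * p ^ m"
    using card p by (intro mult_right_mono) (simp_all only: of_nat_le_iff zero_le_power)
  finally show ?thesis by simp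
qed

text \<open>Here the forbidden edge sets are stars with a centre \<open>v\<close> and
  \<open>m\<close> leaves.\<close>

lemma prob_large_degree:
  fixes p :: real
  assumes p: "0 \<le> p" "p \<le> 1"
  shows "measure_pmf.prob (erdos_renyi n p)
      {E. E \<subseteq> possible_edges n \<and> (\<exists>v\<in>{1..n}. m \<le> card {u \<in> {1..n}. {u, v} \<in> E})}
    \<le> n * (n choose m) * p ^ m"
proof -
  define \<Y> where "\<Y> = {Y. Y \<subseteq> {1..n} \<and> card Y = m}"
  have \<Y>: "finite \<Y>" "card \<Y> = n choose m" unfolding \<Y>_def using n_subsets[of "{1..n}"] by auto
  define \<F> where "\<F> = (\<Union>v\<in>{1..n}. (\<lambda>Y. (\<lambda>u. {u, v}) ` Y) ` {Y \<in> \<Y>. v \<notin> Y})"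
  have \<F>: "finite \<F>" unfolding \<F>_def using \<Y>(1) by auto
  have "card \<F> \<le> (\<Sum>v\<in>{1..n}. card ((\<lambda>Y. (\<lambda>u. {u, v}) ` Y) ` {Y \<in> \<Y>. v \<notin> Y}))" unfolding \<F>_def by (rule card_UN_le) simp
  also have "\<dots> \<le> (\<Sum>v\<in>{1..n}. n choose m)"
  proof (intro sum_mono)
    fix v
    have "card ((\<lambda>Y. (\<lambda>u. {u, v}) ` Y) ` {Y \<in> \<Y>. v \<notin> Y}) \<le> card {Y \<in> \<Y>. v \<notin> Y}" using \<Y>(1) by (intro card_image_le) auto
    also have "\<dots> \<le> card \<Y>" using \<Y>(1) by (intro card_mono) auto
    finally show "card ((\<lambda>Y. (\<lambda>u. {u, v}) ` Y) ` {Y \<in> \<Y>. v \<notin> Y}) \<le> n choose m" using \<Y>(2) by simp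
  qed
  finally have card: "card \<F> \<le> n * (n choose m)" by simp
  have "measure_pmf.prob (erdos_renyi n p)
      {E. E \<subseteq> possible_edges n \<and> (\<exists>v\<in>{1..n}. m \<le> card {u \<in> {1..n}. {u, v} \<in> E})}
     \<le> measure_pmf.prob (erdos_renyi n p) {E. \<exists>F\<in>\<F>. F \<subseteq> E}"
  proof (rule measure_pmf.finite_measure_mono, rule subsetI)
    fix E assume "E \<in> {E. E \<subseteq> possible_edges n \<and> (\<exists>v\<in>{1..n}. m \<le> card {u \<in> {1..n}. {u, v} \<in> E})}"
    then obtain v where E: "E \<subseteq> possible_edges n" and v: "v \<in> {1..n}" "m \<le> card {u \<in> {1..n}. {u, v} \<in> E}" by blast
    obtain Y where Y: "Y \<subseteq> {u \<in> {1..n}. {u, v} \<in> E}" "card Y = m" using v(2) by (meson obtain_subset_with_card_n)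
    have "{v, v} \<notin> E" using E unfolding possible_edges_def by auto
    then have "Y \<in> {Y \<in> \<Y>. v \<notin> Y}" using Y unfolding \<Y>_def by auto
    then have "(\<lambda>u. {u, v}) ` Y \<in> \<F>" using v(1) unfolding \<F>_def by blast
    moreover have "(\<lambda>u. {u, v}) ` Y \<subseteq> E" using Y(1) by blast
    ultimately show "E \<in> {E. \<exists>F\<in>\<F>. F \<subseteq> E}" by blast
  qed auto
  also have "\<dots> \<le> card \<F> * p ^ m"
  proof (rule prob_erdos_renyi_some_superset[OF p \<F>])
    fix F assume "F \<in> \<F>"
    then obtain v Y where F: "F = (\<lambda>u. {u, v}) ` Y" and v: "v \<in> {1..n}" and Y: "Y \<subseteq> {1..n}" "card Y = m" "v \<notin> Y"
      unfolding \<F>_def \<Y>_def by blast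
    have "{u, v} \<in> possible_edges n" if "u \<in> Y" for u
      using that v Y unfolding possible_edges_def by (auto simp: card_2_iff)
    moreover have "inj_on (\<lambda>u. {u, v}) Y" by (auto simp: inj_on_def doubleton_eq_iff)
    ultimately show "F \<subseteq> possible_edges n \<and> card F = m" unfolding F using Y(2) by (auto simp: card_image)
  qed
  also have "\<dots> \<le> real (n * (n choose m)) * p ^ m"
    using card p by (intro mult_right_mono) (simp_all only: of_nat_le_iff zero_le_power)
  finally show ?thesis by simp
qed

section \<open>Estimates for the three expected counts\<close>

lemma binomial_le_power:
  assumes "0 < k"
  shows "real (n choose k) \<le> (3 * n / k) ^ k"
proof -
  \<comment> \<open>A single term of the exponential series is at most the whole. With
    \<open>exp 1 \<le> 3\<close> this leads to the familiar bound \<open>(e * n / k) ^ k\<close>,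
    with 3 in place of \<open>e\<close>.\<close>
  have "(real k ^ k) / fact k \<le> exp (real k)"
  proof -
    have s: "(\<lambda>j. real k ^ j /\<^sub>R fact j) sums exp (real k)" by (rule exp_converges)
    have "(\<Sum>j\<in>{k}. real k ^ j /\<^sub>R fact j) \<le> (\<Sum>j. real k ^ j /\<^sub>R fact j)"
      by (rule sum_le_suminf) (use s in \<open>auto simp: sums_iff\<close>)
    then show ?thesis using s by (simp add: sums_iff divide_inverse mult.commute)
  qed
  also have "\<dots> = exp 1 ^ k" by (simp flip: exp_of_nat_mult)
  also have "\<dots> \<le> 3 ^ k" by (intro power_mono exp_le) auto
  finally have f: "real k ^ k \<le> 3 ^ k * fact k" by (simp add: divide_le_eq)
  have "real (n choose k) * fact k \<le> real n ^ k"
    using binomial_fact_pow[of n k] by (metis of_nat_fact of_nat_le_iff of_nat_mult of_nat_power)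
  then have le: "real (n choose k) * fact k * 3 ^ k \<le> real n ^ k * 3 ^ k" by (intro mult_right_mono) auto
  have "real (n choose k) * real k ^ k \<le> real (n choose k) * (3 ^ k * fact k)"
    using f by (intro mult_left_mono) auto
  also have "\<dots> = real (n choose k) * fact k * 3 ^ k" by simp
  also note le
  also have "real n ^ k * 3 ^ k = (3 * n) ^ k" by (simp add: power_mult_distrib)
  finally have "real (n choose k) * real k ^ k \<le> (3 * n) ^ k" .
  then show ?thesis using assms by (simp add: power_divide pos_le_divide_eq)
qed

text \<open>The base \<open>3 * d / m\<close> is at most 1/4 by \<open>12 * d \<le> m\<close>, and
  \<open>4 ^ m\<close> is at least the square of \<open>n\<close>, which outweighs the
  \<open>n\<close> choices of a centre.\<close>

lemma large_degree_estimate: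
  fixes d :: real
  assumes "0 < d" "0 < n" "12 * d \<le> m" "n \<le> 2 ^ m"
  shows "n * (n choose m) * (d / n) ^ m \<le> 1 / n"
proof -
  have m: "0 < m" using assms(1,3) by (cases m) auto
  have "real (n choose m) * (d / n) ^ m \<le> (3 * n / m) ^ m * (d / n) ^ m"
    using binomial_le_power[OF m] assms by (intro mult_right_mono) auto
  also have "\<dots> = (3 * d / m) ^ m" using assms(2) by (simp flip: power_mult_distrib)
  also have "\<dots> \<le> (1 / 4) ^ m" using assms m by (intro power_mono) (auto simp: field_simps)
  finally have "n * (real (n choose m) * (d / n) ^ m) \<le> n * (1 / 4) ^ m" by (intro mult_left_mono) auto
  also have "\<dots> \<le> 1 / n"
  proof -
    have "real n \<le> 2 ^ m" using assms(4) by (metis of_nat_le_iff of_nat_numeral of_nat_power)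
    then have "real n * n \<le> 2 ^ m * 2 ^ m" by (intro mult_mono) auto
    also have "\<dots> = 4 ^ m" by (simp flip: power_mult_distrib)
    finally show ?thesis using assms(2) by (simp add: field_simps power_divide)
  qed
  finally show ?thesis by (simp add: mult.assoc)
qed

text \<open>With \<open>y = u / n\<close>, the choice of the set costs \<open>(3 / y) ^ u\<close>,
  while its edges contribute at most \<open>(y / 2) ^ (b * u)\<close>, and \<open>8 \<le> b\<close>
  lets the second win. One factor \<open>y\<close> is kept to produce \<open>1 / n\<close>; the
  factor \<open>(1 / 2) ^ u\<close> makes the bound summable over \<open>u\<close>.\<close>

lemma dense_set_estimate:
  fixes d :: real
  assumes "0 < d" "4 * d \<le> b" "8 \<le> b" "0 < u" "u \<le> n"
  shows "(n choose u) * ((u choose 2) choose (b * u)) * (d / n) ^ (b * u) \<le> (1 / 2) ^ u / n"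
proof -
  define y where "y = real u / real n"
  have y: "0 < y" "y \<le> 1" using assms by (auto simp: y_def)
  have c2: "real (u choose 2) \<le> u * u / 2"
  proof -
    have "real (u choose 2) \<le> real (u * (u - 1)) / 2"
      using of_nat_div_le_of_nat[of "u * (u - 1)" 2, where ?'a = real] by (simp add: choose_two)
    also have "\<dots> \<le> real (u * u) / 2" by (intro divide_right_mono) (simp_all only: of_nat_le_iff, simp)
    finally show ?thesis by simp
  qed
  have bu: "0 < b * u" using assms by simp
  have "real ((u choose 2) choose (b * u)) * (d / n) ^ (b * u) \<le> (3 * (u choose 2) / (b * u)) ^ (b * u) * (d / n) ^ (b * u)"
    using binomial_le_power[OF bu, of "u choose 2"] assms by (intro mult_right_mono) auto
  also have "\<dots> = (3 * (u choose 2) / (b * u) * (d / n)) ^ (b * u)" by (simp only: power_mult_distrib)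
  also have "\<dots> \<le> (y / 2) ^ (b * u)"
  proof (rule power_mono)
    have "3 * (u choose 2) / (b * u) * (d / n) \<le> 3 * (u * u / 2) / (b * u) * (d / n)"
      using c2 assms by (intro mult_right_mono divide_right_mono mult_left_mono) auto
    also have "\<dots> = (3 / 2) * (d / b) * y" using assms by (simp add: y_def field_simps)
    also have "\<dots> \<le> (3 / 2) * (1 / 4) * y" using assms y by (intro mult_right_mono mult_left_mono) (auto simp: field_simps)
    finally show "3 * (u choose 2) / (b * u) * (d / n) \<le> y / 2" using y by simp
  qed (use assms in auto)
  also have "\<dots> \<le> (y ^ 2 / 256) ^ u"
  proof -
    have "(y / 2) ^ b \<le> (y / 2) ^ 8" using y assms by (intro power_decreasing) auto
    also have "\<dots> = y ^ 8 / 256" by (simp add: power_divide)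
    also have "\<dots> \<le> y ^ 2 / 256" using y by (intro divide_right_mono power_decreasing) auto
    finally show ?thesis unfolding power_mult using y by (intro power_mono) auto
  qed
  finally have 1: "real ((u choose 2) choose (b * u)) * (d / n) ^ (b * u) \<le> (y ^ 2 / 256) ^ u" .
  have "real (n choose u) \<le> (3 / y) ^ u" using binomial_le_power[OF assms(4), of n] by (simp add: y_def)
  then have "real (n choose u) * (real ((u choose 2) choose (b * u)) * (d / n) ^ (b * u)) \<le> (3 / y) ^ u * (y ^ 2 / 256) ^ u"
    using 1 assms y by (intro mult_mono) auto
  also have "\<dots> = (3 * y / 256) ^ u" using y by (simp add: power2_eq_square flip: power_mult_distrib)
  also have "\<dots> \<le> (y / 4) ^ u" using y by (intro power_mono) auto
  also have "\<dots> = y ^ u * (1 / 4) ^ u" by (simp flip: power_mult_distrib)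
  also have "\<dots> \<le> y * (1 / 4) ^ u" using y assms power_decreasing[of 1 u y] by (intro mult_right_mono) auto
  also have "\<dots> = (u * (1 / 4) ^ u) / n" by (simp add: y_def)
  also have "\<dots> \<le> (1 / 2) ^ u / n"
  proof -
    have "real u \<le> 2 ^ u" using less_exp[of u] by (metis less_imp_le of_nat_le_iff of_nat_numeral of_nat_power)
    then have "u * (1 / 4) ^ u \<le> 2 ^ u * (1 / 4 :: real) ^ u" by (intro mult_right_mono) auto
    also have "\<dots> = (1 / 2) ^ u" by (simp flip: power_mult_distrib)
    finally show ?thesis by (intro divide_right_mono) auto
  qed
  finally show ?thesis by (simp add: mult.assoc)
qed

text \<open>Each of the \<open>l\<close> edges, paired with one vertex, contributes a factor
  \<open>9 * d / h\<close>, at most 1/4 by \<open>36 * d \<le> h\<close>: the block is subcritical.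
  The one vertex left over costs at most \<open>6 * n / h\<close>. All \<open>h\<close> blocks
  together give \<open>6 * n / 4 ^ l\<close>, and \<open>4 * 4 ^ l\<close> exceeds the square of
  \<open>n\<close>.\<close>

lemma short_component_estimate:
  fixes d :: real
  assumes "0 < d" "36 * d \<le> h" "h \<le> n" "c \<le> Suc (n div h)" "1 \<le> l" "n < 2 ^ Suc l"
  shows "h * ((c choose Suc l) * ((Suc l choose 2) choose l) * (d / n) ^ l) \<le> 24 / n"
proof -
  have h: "0 < h" "0 < n" using assms by (auto intro: Nat.gr0I)
  have c: "real c \<le> 2 * n / h"
  proof -
    have "real c \<le> real (n div h) + 1" using assms(4) by linarith
    also have "\<dots> \<le> n / h + n / h"
      using assms(3) h by (intro add_mono of_nat_div_le_of_nat) (simp add: le_divide_eq)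
    finally show ?thesis by simp
  qed
  have c2: "real (Suc l choose 2) \<le> Suc l * l / 2"
    using of_nat_div_le_of_nat[of "Suc l * l" 2, where ?'a = real] by (simp add: choose_two)
  have "real ((Suc l choose 2) choose l) \<le> (3 * real (Suc l choose 2) / l) ^ l"
    using assms(5) by (intro binomial_le_power) auto
  also have "\<dots> \<le> (3 / 2 * Suc l) ^ l" using c2 assms(5) by (intro power_mono) (auto simp: field_simps)
  finally have 2: "real ((Suc l choose 2) choose l) \<le> (3 / 2 * Suc l) ^ l" .
  have "real (c choose Suc l) \<le> (3 * real c / Suc l) ^ Suc l" by (rule binomial_le_power) simp
  also have "\<dots> \<le> (6 * n / h / Suc l) ^ Suc l"
    using c by (intro power_mono divide_right_mono) auto
  finally have 1: "real (c choose Suc l) \<le> (6 * n / h / Suc l) ^ Suc l" .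
  have "real (c choose Suc l) * real ((Suc l choose 2) choose l) * (d / n) ^ l
     \<le> (6 * n / h / Suc l) ^ Suc l * (3 / 2 * Suc l) ^ l * (d / n) ^ l"
    using 1 2 assms(1) by (intro mult_right_mono mult_mono) auto
  also have "\<dots> = 6 * n / h / Suc l * ((6 * n / h / Suc l) * (3 / 2 * Suc l) * (d / n)) ^ l"
    by (simp only: power_mult_distrib power_Suc mult_ac)
  also have "(6 * n / h / Suc l) * (3 / 2 * Suc l) * (d / n) = 9 * d / h" using h by (simp add: divide_simps)
  also have "6 * n / h / Suc l * (9 * d / h) ^ l \<le> 6 * n / h * (1 / 4) ^ l"
  proof (rule mult_mono)
    have "real (6 * n) / h / Suc l \<le> real (6 * n) / h / 1" by (intro divide_left_mono) auto
    then show "real (6 * n) / h / Suc l \<le> real (6 * n) / h" by simp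
    show "(9 * d / h) ^ l \<le> (1 / 4) ^ l" using assms h by (intro power_mono) (auto simp: field_simps)
  qed (use assms in auto)
  finally have "h * (real (c choose Suc l) * real ((Suc l choose 2) choose l) * (d / n) ^ l) \<le> h * (6 * n / h * (1 / 4) ^ l)"
    by (intro mult_left_mono) auto
  also have "\<dots> = 6 * n * (1 / 4) ^ l" using h by simp
  also have "\<dots> \<le> 24 / n"
  proof -
    have "real n \<le> 2 * 2 ^ l" using assms(6) by (metis less_imp_le of_nat_le_iff of_nat_numeral of_nat_power power_Suc)
    then have "real n * n \<le> (2 * 2 ^ l) * (2 * 2 ^ l)" by (intro mult_mono) auto
    also have "\<dots> = 4 * 4 ^ l" by (simp flip: power_mult_distrib)
    finally show ?thesis using h by (simp add: field_simps power_divide)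
  qed
  finally show ?thesis by simp
qed

text \<open>The sets \<open>F1\<close>, \<open>F2\<close> and \<open>F3\<close> describe the
  failures of the three clauses of \<open>tame\<close>. They contribute \<open>1 / n\<close>,
  another \<open>1 / n\<close> after summing a geometric series over \<open>u\<close>, and
  \<open>24 / n\<close> over all blocks.\<close>

lemma prob_tame:
  fixes d :: real
  assumes d: "0 < d" "d \<le> n" and b: "4 * d \<le> b" "8 \<le> b" and h: "36 * d \<le> h" "h \<le> n"
    and l: "1 \<le> l" "12 * d \<le> Suc l" "n < 2 ^ Suc l"
  shows "1 - 26 / n \<le> measure_pmf.prob (erdos_renyi n (d / n)) {E. E \<subseteq> possible_edges n \<and> tame n h b l E}"
proof -
  define M where "M = Suc (n div h)"
  define U where "U j = {x \<in> {1..n}. x div M = j}" for j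
  let ?P = "measure_pmf.prob (erdos_renyi n (d / n))"
  define G where "G = {E. E \<subseteq> possible_edges n \<and> tame n h b l E}"
  define F1 where "F1 = {E. E \<subseteq> possible_edges n \<and> (\<exists>v\<in>{1..n}. Suc l \<le> card {u \<in> {1..n}. {u, v} \<in> E})}"
  define F2 where "F2 u = {E. E \<subseteq> possible_edges n \<and> (\<exists>X\<subseteq>{1..n}. card X = u \<and> b * u \<le> card {e \<in> E. e \<subseteq> X})}" for u
  define F3 where "F3 j = {E. E \<subseteq> possible_edges n \<and> (\<exists>X\<subseteq>U j. card X = Suc l \<and> l \<le> card {e \<in> E. e \<subseteq> X})}" for j
  have n: "0 < n" using d by (auto intro: Nat.gr0I)
  have h0: "0 < h" using d h by (auto intro: Nat.gr0I)
  have p: "0 \<le> d / n" "d / n \<le> 1" using d n by auto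
  have cover: "{E. E \<subseteq> possible_edges n} \<subseteq> G \<union> (F1 \<union> ((\<Union>u\<in>{1..n}. F2 u) \<union> (\<Union>j<h. F3 j)))"
  proof (rule subsetI, rule ccontr)
    fix E assume E: "E \<in> {E. E \<subseteq> possible_edges n}"
      and no: "E \<notin> G \<union> (F1 \<union> ((\<Union>u\<in>{1..n}. F2 u) \<union> (\<Union>j<h. F3 j)))"
    have "tame n h b l E"
      unfolding tame_def
    proof (intro conjI ballI allI impI)
      fix v assume "v \<in> {1..n}"
      then have "\<not> Suc l \<le> card {u \<in> {1..n}. {u, v} \<in> E}" using E no unfolding F1_def by blast
      then show "card {u \<in> {1..n}. {u, v} \<in> E} \<le> l" by simp
    next
      fix X assume X: "X \<subseteq> {1..n}" "X \<noteq> {}"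
      have "finite X" using X finite_subset by blast
      then have "card X \<in> {1..n}" using X card_mono[OF _ X(1)] by (auto simp: Suc_le_eq card_gt_0_iff)
      then have "E \<notin> F2 (card X)" using no by blast
      then have "\<not> b * card X \<le> card {e \<in> E. e \<subseteq> X}" using E X unfolding F2_def by blast
      then show "card {e \<in> E. e \<subseteq> X} < b * card X" by simp
    next
      fix X assume X: "X \<subseteq> {1..n}" "card X = Suc l"
        "\<forall>x\<in>X. \<forall>y\<in>X. x div Suc (n div h) = y div Suc (n div h)"
      obtain x where x: "x \<in> X" using X(2) by (metis card.empty ex_in_conv nat.simps(3))
      have "n < h * M" unfolding M_def using h0 by (simp add: dividend_less_times_div)
      then have "x div M < h" using x X(1) unfolding M_def by (intro less_mult_imp_div_less) (auto simp: mult.commute)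
      then have "E \<notin> F3 (x div M)" using no by blast
      moreover have "X \<subseteq> U (x div M)" using X x unfolding U_def M_def by blast
      ultimately have "\<not> l \<le> card {e \<in> E. e \<subseteq> X}" using E X(2) unfolding F3_def by blast
      then show "card {e \<in> E. e \<subseteq> X} < l" by simp
    qed
    then show False using E no unfolding G_def by blast
  qed
  have P1: "?P F1 \<le> 1 / n"
    using prob_large_degree[OF p, of n "Suc l"] large_degree_estimate[OF d(1) n l(2)] l(3)
    unfolding F1_def by simp
  have "?P (\<Union>u\<in>{1..n}. F2 u) \<le> (\<Sum>u\<in>{1..n}. ?P (F2 u))"
    by (rule measure_pmf.finite_measure_subadditive_finite) auto
  also have "\<dots> \<le> (\<Sum>u\<in>{1..n}. (1 / 2) ^ u / n)"
  proof (intro sum_mono)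
    fix u assume u: "u \<in> {1..n}"
    have "?P (F2 u) \<le> (n choose u) * ((u choose 2) choose (b * u)) * (d / n) ^ (b * u)"
      using prob_dense_subset[OF p order_refl, of n u "b * u"] unfolding F2_def by simp
    also have "\<dots> \<le> (1 / 2) ^ u / n" using dense_set_estimate[OF d(1) b] u by simp
    finally show "?P (F2 u) \<le> (1 / 2) ^ u / n" .
  qed
  also have "\<dots> = (\<Sum>u\<in>{1..n}. (1 / 2) ^ u) / n" by (simp add: sum_divide_distrib)
  also have "\<dots> \<le> 1 / n"
  proof (rule divide_right_mono)
    have "(\<Sum>u\<in>{1..n}. (1 / 2 :: real) ^ u) = 1 - (1 / 2) ^ n" by (induction n) auto
    then show "(\<Sum>u\<in>{1..n}. (1 / 2 :: real) ^ u) \<le> 1" by simp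
  qed simp
  finally have P2: "?P (\<Union>u\<in>{1..n}. F2 u) \<le> 1 / n" .
  have "?P (\<Union>j<h. F3 j) \<le> (\<Sum>j<h. ?P (F3 j))"
    by (rule measure_pmf.finite_measure_subadditive_finite) auto
  also have "\<dots> \<le> (\<Sum>j<h. 24 / n / h)"
  proof (intro sum_mono)
    fix j
    have "U j \<subseteq> {j * M..<j * M + M}"
    proof
      fix x assume "x \<in> U j"
      then have "x = j * M + x mod M" unfolding U_def using div_mult_mod_eq[of x M] by simp
      moreover have "x mod M < M" unfolding M_def by simp
      ultimately show "x \<in> {j * M..<j * M + M}" by simp
    qed
    then have c: "card (U j) \<le> Suc (n div h)" using card_mono[of "{j * M..<j * M + M}" "U j"] unfolding M_def by simp
    have "?P (F3 j) \<le> (card (U j) choose Suc l) * ((Suc l choose 2) choose l) * (d / n) ^ l"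
      unfolding F3_def by (rule prob_dense_subset[OF p]) (auto simp: U_def)
    moreover have "h * ((card (U j) choose Suc l) * ((Suc l choose 2) choose l) * (d / n) ^ l) \<le> 24 / n"
      by (rule short_component_estimate[OF d(1) h c l(1,3)])
    ultimately have "h * ?P (F3 j) \<le> 24 / n" by (smt (verit) mult_left_mono of_nat_0_le_iff)
    then show "?P (F3 j) \<le> 24 / n / h" using h0 by (subst pos_le_divide_eq) (simp_all add: mult.commute)
  qed
  also have "\<dots> = 24 / n" using h0 by simp
  finally have P3: "?P (\<Union>j<h. F3 j) \<le> 24 / n" .
  have "1 = ?P {E. E \<subseteq> possible_edges n}"
    using measure_pmf.prob_eq_1[of "{E. E \<subseteq> possible_edges n}" "erdos_renyi n (d / n)"]
    by (simp add: AE_measure_pmf_iff erdos_renyi_subset)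
  also have "\<dots> \<le> ?P (G \<union> (F1 \<union> ((\<Union>u\<in>{1..n}. F2 u) \<union> (\<Union>j<h. F3 j))))"
    by (rule measure_pmf.finite_measure_mono[OF cover]) simp
  also have "\<dots> \<le> ?P G + ?P (F1 \<union> ((\<Union>u\<in>{1..n}. F2 u) \<union> (\<Union>j<h. F3 j)))"
    by (rule measure_Un_le) auto
  also have "\<dots> \<le> ?P G + (?P F1 + ?P ((\<Union>u\<in>{1..n}. F2 u) \<union> (\<Union>j<h. F3 j)))"
    by (intro add_left_mono measure_Un_le) auto
  also have "\<dots> \<le> ?P G + (?P F1 + (?P (\<Union>u\<in>{1..n}. F2 u) + ?P (\<Union>j<h. F3 j)))"
    by (intro add_left_mono measure_Un_le) auto
  finally have "1 \<le> ?P G + (1 / n + (1 / n + 24 / n))" using P1 P2 P3 by linarith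
  also have "1 / n + (1 / n + 24 / n) = 26 / real n" by (simp flip: add_divide_distrib)
  finally show ?thesis unfolding G_def by linarith
qed

subsection \<open>The bound on the Ramsey number\<close>

text \<open>\<open>Least_le\<close> asks for the property at \<open>N\<close> alone, so only
  tournaments with exactly \<open>N\<close> vertices have to be considered.\<close>

lemma oriented_ramsey_le:
  fixes E :: "nat set set" and \<delta> \<epsilon> :: real
  assumes tame: "tame n (2 ^ k) b l E" and E: "E \<subseteq> possible_edges n"
    and l: "1 \<le> l" "2 ^ l \<le> n"
    and \<delta>: "\<delta> = 1 / (64 * (2 ^ k)\<^sup>2 * (real l)\<^sup>2)" and \<epsilon>: "\<epsilon> = (\<delta> / 2) ^ (2 * b) / (4 * l)"
    and big: "8 * n \<le> (\<epsilon> / 2) ^ k * (\<delta> / 2) ^ (2 * b) * N"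
  shows "oriented_ramsey (orient_edges n E) \<le> N"
  unfolding oriented_ramsey_def
proof (rule Least_le, intro allI impI, elim conjE)
  fix T :: "nat pair_pre_digraph"
  assume T: "tournament T" and N: "card (pverts T) = N"
  then have "pair_fin_digraph T" unfolding tournament_def by (simp add: pair_digraph_def)
  then have "finite (pverts T)" by (rule pair_fin_digraph.pair_finite_verts)
  then have A: "semicomplete_on (parcs T) (pverts T)"
    using T unfolding tournament_def semicomplete_on_def by blast
  have "card e = 2" if "e \<in> E" for e using that E unfolding possible_edges_def by auto
  from tame_embedding[OF tame this A l \<delta> \<epsilon>] big N
  obtain f where f: "inj_on f {1..n}" "f ` {1..n} \<subseteq> pverts T"
    "\<forall>u\<in>{1..n}. \<forall>v\<in>{1..n}. u < v \<longrightarrow> {u, v} \<in> E \<longrightarrow> (f u, f v) \<in> parcs T" by auto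
  have "(f u, f v) \<in> parcs T" if "u < v" "{u, v} \<in> E" for u v
    using that f(3) E unfolding possible_edges_def by auto
  then show "contains_copy T (orient_edges n E)"
    using f(1,2) unfolding contains_copy_def orient_edges_def by (intro exI[of _ f]) auto
qed

text \<open>Constants depending on \<open>k\<close> are absorbed into powers of \<open>l\<close>:
  \<open>128 * (2 ^ k)\<^sup>2 \<le> l\<close> makes \<open>\<delta> / 2\<close> at least
  \<open>1 / l ^ 3\<close>, and then \<open>8 \<le> l\<close> makes \<open>\<epsilon> / 2\<close> at
  least \<open>1 / l ^ (6 * b + 2)\<close>.\<close>

lemma size_estimate:
  fixes \<delta> \<epsilon> :: real
  assumes l: "8 \<le> l" "128 * (2 ^ k)\<^sup>2 \<le> l"
    and \<delta>: "\<delta> = 1 / (64 * (2 ^ k)\<^sup>2 * (real l)\<^sup>2)" and \<epsilon>: "\<epsilon> = (\<delta> / 2) ^ (2 * b) / (4 * l)"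
  shows "1 / real l ^ ((6 * b + 2) * k + 6 * b) \<le> (\<epsilon> / 2) ^ k * (\<delta> / 2) ^ (2 * b)"
proof -
  have l0: "0 < real l" using l by simp
  have "real (128 * (2 ^ k)\<^sup>2) \<le> real l" using l(2) by (simp only: of_nat_le_iff)
  then have "128 * (2 ^ k)\<^sup>2 * (real l)\<^sup>2 \<le> real l * (real l)\<^sup>2" by (intro mult_right_mono) auto
  then have "128 * (2 ^ k)\<^sup>2 * (real l)\<^sup>2 \<le> real l ^ 3" by (simp add: power3_eq_cube power2_eq_square)
  then have "1 / real l ^ 3 \<le> 1 / (128 * (2 ^ k)\<^sup>2 * (real l)\<^sup>2)" using l0 by (intro divide_left_mono) auto
  also have "\<dots> = \<delta> / 2" unfolding \<delta> by simp
  finally have "(1 / real l ^ 3) ^ (2 * b) \<le> (\<delta> / 2) ^ (2 * b)" by (intro power_mono) auto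
  then have 1: "1 / real l ^ (6 * b) \<le> (\<delta> / 2) ^ (2 * b)"
    by (simp add: power_divide flip: power_mult)
  have "1 / real l ^ (6 * b + 2) = (1 / real l ^ (6 * b)) / (l * l)" by (simp add: power_add power2_eq_square)
  also have "\<dots> \<le> (\<delta> / 2) ^ (2 * b) / (8 * l)"
    using 1 l0 l(1) by (intro frac_le) auto
  also have "\<dots> = \<epsilon> / 2" unfolding \<epsilon> by simp
  finally have "(1 / real l ^ (6 * b + 2)) ^ k \<le> (\<epsilon> / 2) ^ k" by (intro power_mono) auto
  then have "1 / real l ^ ((6 * b + 2) * k) \<le> (\<epsilon> / 2) ^ k" by (simp only: power_divide power_one power_mult)
  then have "1 / real l ^ ((6 * b + 2) * k) * (1 / real l ^ (6 * b)) \<le> (\<epsilon> / 2) ^ k * (\<delta> / 2) ^ (2 * b)"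
    using 1 by (intro mult_mono) (auto intro: order_trans[rotated])
  then show ?thesis by (simp add: power_add)
qed

text \<open>With \<open>t = log 2 d \<ge> 1\<close>, bounding 36 by 64 gives
  \<open>k \<le> 8 * t\<close>, and \<open>6 * b + 2 \<le> 28 * d\<close>. The sum is thus at most
  \<open>252 * d * t\<close>, and \<open>t \<ge> 1\<close> allows passing to the square of
  \<open>t\<close>.\<close>

lemma exponent_estimate:
  fixes d :: real and b k :: nat
  assumes d: "2 \<le> d" and b: "b \<le> 4 * d + 1" and k: "k \<le> log 2 (36 * d) + 1"
  shows "(6 * b + 2) * k + 6 * b + 1 \<le> 300 * d * (log 2 d)\<^sup>2"
proof -
  define t where "t = log 2 d"
  have t: "1 \<le> t" unfolding t_def using d by simp
  have "log 2 36 \<le> log 2 (2 ^ 6 :: real)" by (subst log_le_cancel_iff) auto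
  also have "\<dots> = 6" by (subst log_nat_power) auto
  finally have "log 2 36 \<le> (6 :: real)" .
  moreover have "log 2 (36 * d) = log 2 36 + t" unfolding t_def using d by (simp add: log_mult)
  ultimately have "k \<le> 8 * t" using k t by linarith
  moreover have "6 * b + 2 \<le> 28 * d" using b d by linarith
  ultimately have "(6 * b + 2) * k \<le> 28 * d * (8 * t)" unfolding of_nat_mult using d by (intro mult_mono) auto
  moreover have "6 * b + 2 \<le> 28 * d * t"
    using \<open>6 * b + 2 \<le> 28 * d\<close> mult_left_mono[OF t, of "28 * d"] d by linarith
  ultimately have "(6 * b + 2) * k + (6 * b + 2) \<le> 252 * d * t" by linarith
  also have "\<dots> \<le> 300 * d * t" using d t by (intro mult_right_mono) auto
  also have "\<dots> \<le> 300 * d * t\<^sup>2" using d t by (intro mult_left_mono) (auto simp: power2_eq_square)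
  finally show ?thesis unfolding t_def by simp
qed

text \<open>The number of vertices of a tournament must be an integer. As \<open>n * l ^ m\<close>
  is one, it stays below the floor of the real target.\<close>

lemma floor_room:
  fixes L e :: real
  assumes "2 \<le> l" "real l \<le> L" "m \<le> e"
  shows "n * l ^ m \<le> nat \<lfloor>n * L powr e\<rfloor>"
proof -
  have "real l powr m \<le> real l powr e" using assms by (intro powr_mono) auto
  also have "\<dots> \<le> L powr e" using assms by (intro powr_mono2) auto
  finally have "n * real l powr m \<le> n * L powr e" by (intro mult_left_mono) auto
  then have "real (n * l ^ m) \<le> n * L powr e" using assms(1) by (simp add: powr_realpow)
  then show ?thesis by (rule le_nat_floor)
qed

theorem corollary4p8:
  shows "\<exists>C::real. \<forall>d::real. d \<ge> 2 \<longrightarrow>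
    (\<lambda>n::nat. measure_pmf.prob (random_acyclic_digraph n (d / real n))
       {H. real (oriented_ramsey H) \<le> real n * (log 2 (real n)) powr (C * d * (log 2 d)\<^sup>2)})
      \<longlonglongrightarrow> 1"
proof (intro exI[of _ 300] allI impI)
  fix d :: real
  assume d: "2 \<le> d"
  define e where "e = 300 * d * (log 2 d)\<^sup>2"
  \<comment> \<open>Both \<open>b\<close> and \<open>k\<close> depend on \<open>d\<close> only.
    Rounding up gives the least \<open>b\<close> with \<open>4 * d \<le> b\<close> and the least
    power of two \<open>h\<close> with \<open>36 * d \<le> h\<close>, as the estimates for dense
    sets and for short components require.\<close>
  define b where "b = nat \<lceil>4 * d\<rceil>"
  define k where "k = nat \<lceil>log 2 (36 * d)\<rceil>"
  define h :: nat where "h = 2 ^ k"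
  define m where "m = (6 * b + 2) * k + 6 * b"
  have b: "4 * d \<le> b" "8 \<le> b" "b \<le> 4 * d + 1" using d unfolding b_def by linarith+
  have "0 \<le> log 2 (36 * d)" using d by simp
  then have k: "log 2 (36 * d) \<le> k" "k \<le> log 2 (36 * d) + 1" unfolding k_def by linarith+
  have h: "36 * d \<le> h"
    using k(1) d unfolding h_def by (simp add: log_le_iff powr_realpow)
  have m: "m + 1 \<le> e" using exponent_estimate[OF d b(3) k(2)] unfolding m_def e_def of_nat_add by simp
  \<comment> \<open>From \<open>n = 2 ^ L0\<close> on, \<open>l\<close> is at least every constant
    that the lemmas ask for; through \<open>l < n\<close> this also yields \<open>d \<le> n\<close>
    and \<open>h \<le> n\<close>.\<close>
  obtain L0 :: nat where L0: "8 + d + 12 * d + h + 128 * h\<^sup>2 \<le> L0" using real_arch_simple by blast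
  let ?f = "\<lambda>n. measure_pmf.prob (random_acyclic_digraph n (d / real n))
       {H. real (oriented_ramsey H) \<le> real n * (log 2 (real n)) powr e}"
  have bound: "1 - 26 / n \<le> ?f n" if n: "2 ^ L0 \<le> n" for n
  proof -
    define l where "l = nat \<lfloor>log 2 n\<rfloor>"
    have n0: "0 < n" using n by (auto intro: Nat.gr0I)
    have "real (2 ^ L0) \<le> real n" using n by (simp only: of_nat_le_iff)
    then have logn: "L0 \<le> log 2 n" using n0 by (simp add: le_log_iff powr_realpow)
    then have L0l: "L0 \<le> l" unfolding l_def by linarith
    have l_le: "l \<le> log 2 n" "log 2 n < Suc l" using logn unfolding l_def by linarith+
    have "2 ^ l \<le> real n" using l_le(1) n0 by (simp add: le_log_iff powr_realpow)
    then have nl: "2 ^ l \<le> n" by (simp flip: of_nat_le_iff)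
    have "real n < 2 ^ Suc l" using l_le(2) n0 by (simp only: log_less_iff powr_realpow of_nat_0_less_iff)
    then have nSl: "n < 2 ^ Suc l" by (metis of_nat_less_iff of_nat_numeral of_nat_power)
    have ln: "l < n" using nl less_exp[of l] by linarith
    have l8: "8 \<le> l" "12 * d \<le> Suc l" "d \<le> l" "h \<le> l" "128 * h\<^sup>2 \<le> l"
    proof -
      have "8 + d + 12 * d + h + real (128 * h\<^sup>2) \<le> l" using L0 L0l by simp
      then have "8 \<le> real l" "12 * d \<le> Suc l" "d \<le> l" "real h \<le> l" "real (128 * h\<^sup>2) \<le> l" using d by linarith+
      then show "8 \<le> l" "12 * d \<le> Suc l" "d \<le> l" "h \<le> l" "128 * h\<^sup>2 \<le> l" by linarith+
    qed
    define N where "N = nat \<lfloor>n * log 2 n powr e\<rfloor>"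
    define \<delta> where "\<delta> = 1 / (64 * (2 ^ k)\<^sup>2 * (real l)\<^sup>2)"
    define \<epsilon> where "\<epsilon> = (\<delta> / 2) ^ (2 * b) / (4 * real l)"
    \<comment> \<open>One further power of \<open>l\<close> absorbs the factor 8 of
      \<open>8 * n\<close>; this is the \<open>+ 1\<close> in \<open>m + 1 \<le> e\<close>.\<close>
    have "8 * n * l ^ m = n * (8 * l ^ m)" by simp
    also have "\<dots> \<le> n * l ^ (m + 1)" using l8(1) by simp
    also have "\<dots> \<le> N" unfolding N_def by (rule floor_room) (use l8 l_le m in auto)
    finally have "real (8 * n * l ^ m) \<le> real N" by (simp only: of_nat_le_iff)
    then have "8 * real n * real l ^ m \<le> N" by simp
    then have "8 * real n \<le> 1 / real l ^ m * N" using l8(1) by (simp add: field_simps)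
    also have "\<dots> \<le> (\<epsilon> / 2) ^ k * (\<delta> / 2) ^ (2 * b) * N"
      unfolding m_def using l8(1,5) h_def
      by (intro mult_right_mono size_estimate) (auto simp: \<delta>_def \<epsilon>_def)
    finally have big: "8 * real n \<le> (\<epsilon> / 2) ^ k * (\<delta> / 2) ^ (2 * b) * N" .
    have ramsey: "real (oriented_ramsey (orient_edges n E)) \<le> n * log 2 n powr e"
      if "E \<subseteq> possible_edges n" "tame n h b l E" for E
    proof -
      have "oriented_ramsey (orient_edges n E) \<le> N"
        using oriented_ramsey_le[OF _ that(1) _ nl \<delta>_def \<epsilon>_def big] that(2) l8(1) unfolding h_def by simp
      then have "real (oriented_ramsey (orient_edges n E)) \<le> N" by simp
      also have "\<dots> \<le> n * log 2 n powr e" unfolding N_def by (simp add: of_nat_floor)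
      finally show ?thesis .
    qed
    have "1 - 26 / n \<le> measure_pmf.prob (erdos_renyi n (d / n)) {E. E \<subseteq> possible_edges n \<and> tame n h b l E}"
      using d b h l8 ln nSl by (intro prob_tame) auto
    also have "\<dots> \<le> measure_pmf.prob (erdos_renyi n (d / n))
        (orient_edges n -` {H. real (oriented_ramsey H) \<le> real n * (log 2 (real n)) powr e})"
      by (rule measure_pmf.finite_measure_mono) (use ramsey in auto)
    also have "\<dots> = ?f n" unfolding random_acyclic_digraph_def measure_map_pmf ..
    finally show ?thesis .
  qed
  have "?f \<longlonglongrightarrow> 1"
  proof (rule tendsto_sandwich)
    show "\<forall>\<^sub>F n in sequentially. 1 - 26 / real n \<le> ?f n"
      using bound by (rule eventually_sequentiallyI)
    show "\<forall>\<^sub>F n in sequentially. ?f n \<le> 1" by simp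
    have "(\<lambda>n. 1 - 26 / real n) \<longlonglongrightarrow> 1 - 0"
      by (intro tendsto_diff tendsto_const lim_const_over_n)
    then show "(\<lambda>n. 1 - 26 / real n) \<longlonglongrightarrow> 1" by simp
  qed simp
  then show "(\<lambda>n::nat. measure_pmf.prob (random_acyclic_digraph n (d / real n))
       {H. real (oriented_ramsey H) \<le> real n * (log 2 (real n)) powr (300 * d * (log 2 d)\<^sup>2)})
      \<longlonglongrightarrow> 1" unfolding e_def .
qed

end
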